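(* There exists a constant $C > 1$ such that the following holds. Let $m, n \in \mathbb{N}$ with $m \le 2n/3$, and let $\varepsilon > 0$. Let $A \subseteq [n]$ be a $p$-random subset, where $$\frac{C \log (1/\varepsilon)}{\sqrt{\varepsilon^3 m}} \le p \le 1/2.$$ Then $$\Pr\Big( \big| [2n] \setminus (A+A) \big| \ge m \Big) < (1-p)^{m/2 - \varepsilon m}.$$
   Context: $\mathbb{N} = \{1,2,3,\dots\}$ and for real $x$, $[x] = \{k \in \mathbb{N} : 1 \le k \le x\}$. For $A \subseteq \mathbb{N}$, $A + A = \{a+b : a, b \in A\}$. A $p$-random subset of a finite set $X$ is obtained by including each element of $X$ independently with probability $p$. All logarithms are base 2.
   Formalization: The formal statement adds the hypothesis p > 0; for ε ≥ 1 the English also admits p = 0, where the claim fails because it reads 1 < 1 (for ε < 1 positivity of p already follows from its lower bound). *)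

theory Defs
  imports "HOL-Probability.Probability" "HOL-Library.Set_Algebras"
begin

text \<open>
  Meaningful for finite \<open>X\<close> and \<open>0 \<le> p \<le> 1\<close>; \<^const>\<open>Pi_pmf\<close> is the product
  of independent coin flips indexed by \<open>X\<close>.
\<close>

definition random_subset_pmf :: "'a set \<Rightarrow> real \<Rightarrow> 'a set pmf" where
  "random_subset_pmf X p =
     map_pmf (\<lambda>f. {x \<in> X. f x}) (Pi_pmf X False (\<lambda>_. bernoulli_pmf p))"

end

theory Submission
  imports Defs
begin

text \<open>
  Write \<open>1 - p = exp (- 2\<kappa>)\<close>. Weighting each sum that does occur by \<open>exp (- \<kappa>)\<close>
  gives a forbidden element of \<open>[N]\<close> exactly twice the cost of a forbidden sum, which is the
  exchange rate of \<open>|S + S| \<ge> 2|S| - 1\<close>. The weighted sum over \<open>A\<close> is bounded by a container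
  argument: as long as the undetermined set \<open>S\<close> has a minimum or maximum \<open>x\<close> for which many
  elements of \<open>x + S\<close> are uncovered, ask whether \<open>x \<in> A\<close>, and put \<open>x\<close> in a fingerprint \<open>F\<close> if so;
  an element or a sum with many incidences in the bipartite graph \<open>u \<in> y + F\<close> is queried at once.
  Positive answers are rare because each of them is paid for by a potential, and when the process
  stops the two translates of \<open>S\<close> by its extremes show that few sums remain uncovered.

  This suffices for \<open>n = O(m)\<close>. For larger \<open>n\<close>, a Janson-type inequality applied to the sets of
  \<open>\<lfloor>1/p\<rfloor>\<close> missing sums shows that few sums outside the two end intervals of length
  \<open>34m\<close> are missing, and the two ends of \<open>A\<close> are glued together to a random subset of \<open>[68m]\<close>.
\<close>

section \<open>Finite expectations over random subsets\<close>

text \<open>Expectation over a \<open>p\<close>-random subset of \<open>V\<close>, kept as an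
  explicit finite sum so that the ground set can be changed element by element in
  inductions.\<close>

definition ev :: "real \<Rightarrow> 'a set \<Rightarrow> ('a set \<Rightarrow> real) \<Rightarrow> real" where
  "ev p V g = (\<Sum>A\<in>Pow V. p ^ card A * (1 - p) ^ card (V - A) * g A)"

lemma ev_empty [simp]: "ev p {} g = g {}"
  by (simp add: ev_def)

lemma ev_insert:
  assumes "finite V" "x \<notin> V"
  shows "ev p (insert x V) g = (1 - p) * ev p V g + p * ev p V (\<lambda>A. g (insert x A))"
proof -
  let ?f = "\<lambda>A. p ^ card A * (1 - p) ^ card (insert x V - A) * g A"
  have disj: "Pow V \<inter> insert x ` Pow V = {}"
    using assms by auto
  have inj: "inj_on (insert x) (Pow V)"
    using assms by (intro inj_onI) (metis Diff_insert_absorb PowD subset_eq)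
  have "ev p (insert x V) g = sum ?f (Pow V) + sum ?f (insert x ` Pow V)"
    unfolding ev_def Pow_insert using assms disj by (intro sum.union_disjoint) auto
  also have "sum ?f (Pow V) = (1 - p) * ev p V g"
    unfolding ev_def sum_distrib_left
  proof (rule sum.cong[OF refl])
    fix A assume "A \<in> Pow V"
    then have "insert x V - A = insert x (V - A)" "finite (V - A)" "x \<notin> V - A"
      using assms by auto
    then show "?f A = (1 - p) * (p ^ card A * (1 - p) ^ card (V - A) * g A)"
      by simp
  qed
  also have "sum ?f (insert x ` Pow V) = (\<Sum>A\<in>Pow V. ?f (insert x A))"
    using inj by (simp add: sum.reindex)
  also have "\<dots> = p * ev p V (\<lambda>A. g (insert x A))"
    unfolding ev_def sum_distrib_left
  proof (rule sum.cong[OF refl])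
    fix A assume A: "A \<in> Pow V"
    then have "insert x V - insert x A = V - A" "finite A" "x \<notin> A"
      using assms finite_subset by auto
    then show "?f (insert x A) = p * (p ^ card A * (1 - p) ^ card (V - A) * g (insert x A))"
      by simp
  qed
  finally show ?thesis .
qed

text \<open>Conditioning on whether \<open>x\<close> is chosen; this is how queries about single
  elements enter below.\<close>

lemma ev_remove:
  assumes "finite V" "x \<in> V"
  shows "ev p V g = (1 - p) * ev p (V - {x}) g + p * ev p (V - {x}) (\<lambda>A. g (insert x A))"
  using ev_insert[of "V - {x}" x p g] assms by (simp add: insert_absorb)

lemma ev_mono:
  assumes "0 \<le> p" "p \<le> 1" "\<And>A. A \<subseteq> V \<Longrightarrow> f A \<le> g A"
  shows "ev p V f \<le> ev p V g"
  unfolding ev_def using assms by (intro sum_mono mult_left_mono) auto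

lemma ev_cong:
  assumes "\<And>A. A \<subseteq> V \<Longrightarrow> f A = g A"
  shows "ev p V f = ev p V g"
  unfolding ev_def using assms by (intro sum.cong) auto

lemma ev_cmult: "ev p V (\<lambda>A. c * f A) = c * ev p V f"
  by (simp add: ev_def sum_distrib_left mult_ac)

lemma ev_add: "ev p V (\<lambda>A. f A + g A) = ev p V f + ev p V g"
  by (simp add: ev_def sum.distrib distrib_left)

lemma ev_sum: "ev p V (\<lambda>A. \<Sum>i\<in>I. f i A) = (\<Sum>i\<in>I. ev p V (f i))"
  unfolding ev_def by (subst sum.swap) (simp add: sum_distrib_left)

lemma ev_const: "finite V \<Longrightarrow> ev p V (\<lambda>A. c) = c"
  by (induction V rule: finite_induct) (auto simp: ev_insert algebra_simps)

lemma ev_restrict: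
  assumes "finite V" "W \<subseteq> V"
  shows "ev p V (\<lambda>A. g (A \<inter> W)) = ev p W g"
  using assms
proof (induction V arbitrary: W g rule: finite_induct)
  case empty
  then show ?case by simp
next
  case (insert x V)
  show ?case
  proof (cases "x \<in> W")
    case True
    have W: "W - {x} \<subseteq> V" using insert.prems by auto
    have eq: "A \<inter> W = A \<inter> (W - {x})" "insert x A \<inter> W = insert x (A \<inter> (W - {x}))" if "A \<subseteq> V" for A
      using that True insert.hyps by auto
    have "ev p (insert x V) (\<lambda>A. g (A \<inter> W))
        = (1 - p) * ev p V (\<lambda>A. g (A \<inter> (W - {x}))) + p * ev p V (\<lambda>A. g (insert x (A \<inter> (W - {x}))))"
      using insert.hyps by (simp add: ev_insert eq cong: ev_cong)
    also have "\<dots> = (1 - p) * ev p (W - {x}) g + p * ev p (W - {x}) (\<lambda>A. g (insert x A))"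
      using insert.IH[OF W] insert.IH[OF W, of "\<lambda>A. g (insert x A)"] by simp
    also have "\<dots> = ev p W g"
      using ev_remove[of W x p g] True insert finite_subset[OF insert.prems] by simp
    finally show ?thesis .
  next
    case False
    then have W: "W \<subseteq> V" using insert.prems by auto
    have eq: "insert x A \<inter> W = A \<inter> W" for A using False by auto
    show ?thesis
      using insert.hyps insert.IH[OF W] by (simp add: ev_insert eq algebra_simps)
  qed
qed

text \<open>Query the elements of \<open>Q\<close> one after another: only the branch with all
  answers negative survives, at a factor \<open>1 - p\<close> for each.\<close>

lemma ev_avoid:
  assumes "finite V" "Q \<subseteq> V"
  shows "ev p V (\<lambda>A. if A \<inter> Q = {} then g A else 0) = (1 - p) ^ card Q * ev p (V - Q) g"
proof -
  have "finite Q" using assms finite_subset by auto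
  then show ?thesis using assms
  proof (induction Q arbitrary: V rule: finite_induct)
    case empty
    then show ?case by simp
  next
    case (insert x Q)
    have "ev p V (\<lambda>A. if A \<inter> insert x Q = {} then g A else 0) =
        (1 - p) * ev p (V - {x}) (\<lambda>A. if A \<inter> insert x Q = {} then g A else 0) + p * ev p (V - {x}) (\<lambda>A. 0)"
      using insert by (subst ev_remove[of V x]) auto
    also have "\<dots> = (1 - p) * ev p (V - {x}) (\<lambda>A. if A \<inter> insert x Q = {} then g A else 0)"
      using insert by (simp add: ev_const)
    also have "ev p (V - {x}) (\<lambda>A. if A \<inter> insert x Q = {} then g A else 0)
        = ev p (V - {x}) (\<lambda>A. if A \<inter> Q = {} then g A else 0)"
      by (intro ev_cong if_cong) auto
    also have "\<dots> = (1 - p) ^ card Q * ev p (V - {x} - Q) g"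
      using insert by (intro insert.IH) auto
    also have "V - {x} - Q = V - insert x Q" by auto
    finally show ?case using insert by simp
  qed
qed

lemma ev_image:
  assumes "finite V" "inj_on h V"
  shows "ev p (h ` V) g = ev p V (\<lambda>A. g (h ` A))"
  using assms
proof (induction V arbitrary: g rule: finite_induct)
  case empty
  then show ?case by simp
next
  case (insert x V)
  then have "h x \<notin> h ` V" "inj_on h V" by auto
  then show ?case using insert by (simp add: ev_insert)
qed

lemma prob_random_subset:
  assumes "finite X" "0 < p" "p < 1"
  shows "measure_pmf.prob (random_subset_pmf X p) E = ev p X (indicator E)"
proof -
  let ?M = "Pi_pmf X False (\<lambda>_. bernoulli_pmf p)"
  let ?h = "\<lambda>f. {x \<in> X. f x}"
  have set: "set_pmf ?M \<subseteq> {f. \<forall>x. x \<notin> X \<longrightarrow> \<not> f x}"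
    using set_Pi_pmf_subset[OF assms(1), of False "\<lambda>_. bernoulli_pmf p"] by auto
  have pmf: "pmf (random_subset_pmf X p) A = p ^ card A * (1 - p) ^ card (X - A)" if "A \<subseteq> X" for A
  proof -
    let ?f = "\<lambda>x. x \<in> A"
    have A: "?h ?f = A" using that by auto
    have fin: "finite A" using that assms(1) finite_subset by auto
    have pos: "pmf ?M ?f = (\<Prod>x\<in>X. pmf (bernoulli_pmf p) (x \<in> A))"
      using assms that by (intro pmf_Pi') auto
    have "pmf (random_subset_pmf X p) (?h ?f) = measure_pmf.prob ?M (?h -` {A})"
      unfolding random_subset_pmf_def A pmf_map ..
    also have "\<dots> = measure_pmf.prob ?M {?f}"
    proof (rule measure_pmf.finite_measure_eq_AE)
      \<comment> \<open>Almost surely \<open>f\<close> has the default value \<open>False\<close>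
        outside \<open>X\<close>, so its true points in \<open>X\<close> determine it.\<close>
      show "AE f in measure_pmf ?M. (f \<in> ?h -` {A}) = (f \<in> {?f})"
        using set that by (intro AE_pmfI) (auto simp: fun_eq_iff)
    qed auto
    also have "\<dots> = (\<Prod>x\<in>X. if x \<in> A then p else 1 - p)"
      unfolding measure_pmf_single pos using assms by (intro prod.cong) auto
    also have "\<dots> = (\<Prod>x\<in>A. p) * (\<Prod>x\<in>X - A. 1 - p)"
      using that assms(1) fin by (subst prod.subset_diff[of A X]) (auto intro!: arg_cong2[of _ _ _ _ "(*)"] prod.cong simp: mult.commute)
    finally show ?thesis by (simp add: A)
  qed
  have sub: "set_pmf (random_subset_pmf X p) \<subseteq> Pow X"
    by (auto simp: random_subset_pmf_def)
  have "measure_pmf.prob (random_subset_pmf X p) E = measure_pmf.prob (random_subset_pmf X p) (E \<inter> Pow X)"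
    using sub by (intro measure_pmf.finite_measure_eq_AE AE_pmfI) auto
  also have "\<dots> = (\<Sum>A\<in>E \<inter> Pow X. pmf (random_subset_pmf X p) A)"
    using assms by (intro measure_measure_pmf_finite) auto
  also have "\<dots> = (\<Sum>A\<in>E \<inter> Pow X. p ^ card A * (1 - p) ^ card (X - A))"
    using pmf by (intro sum.cong) auto
  also have "\<dots> = ev p X (indicator E)"
    unfolding ev_def using assms(1)
    by (intro sum.mono_neutral_cong_left) (auto simp: indicator_def)
  finally show ?thesis .
qed

section \<open>Containers for sumsets\<close>

text \<open>Each deleted vertex takes at most \<open>G\<close> edges with it; edges between
  \<open>S'\<close> and \<open>U'\<close> may be counted twice.\<close>

lemma card_incidence_remove:
  fixes R :: "'a \<Rightarrow> 'b \<Rightarrow> bool"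
  assumes fin: "finite S" "finite U" and sub: "S' \<subseteq> S" "U' \<subseteq> U"
    and degS: "\<And>y. y \<in> S \<Longrightarrow> card {u \<in> U. R y u} \<le> G"
    and degU: "\<And>u. u \<in> U \<Longrightarrow> card {y \<in> S. R y u} \<le> G"
  shows "card {(y, u). y \<in> S \<and> u \<in> U \<and> R y u}
    \<le> card {(y, u). y \<in> S - S' \<and> u \<in> U - U' \<and> R y u} + G * (card S' + card U')"
proof -
  let ?P = "Sigma S' (\<lambda>y. {u \<in> U. R y u})"
  let ?Q = "prod.swap ` Sigma U' (\<lambda>u. {y \<in> S. R y u})"
  let ?E = "{(y, u). y \<in> S - S' \<and> u \<in> U - U' \<and> R y u}"
  have fins: "finite S'" "finite U'" using fin sub finite_subset by auto
  have finE: "finite ?E" by (rule finite_subset[of _ "S \<times> U"]) (use fin in auto)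
  have "card ?P = (\<Sum>y\<in>S'. card {u \<in> U. R y u})" using fins fin by simp
  also have "\<dots> \<le> of_nat (card S') * G" using degS sub by (intro sum_bounded_above) auto
  finally have P: "card ?P \<le> G * card S'" by (simp add: mult.commute)
  have "card ?Q \<le> card (Sigma U' (\<lambda>u. {y \<in> S. R y u}))"
    using fins fin by (intro card_image_le) auto
  also have "\<dots> = (\<Sum>u\<in>U'. card {y \<in> S. R y u})" using fins fin by simp
  also have "\<dots> \<le> of_nat (card U') * G" using degU sub by (intro sum_bounded_above) auto
  finally have Q: "card ?Q \<le> G * card U'" by (simp add: mult.commute)
  have "card {(y, u). y \<in> S \<and> u \<in> U \<and> R y u} \<le> card (?E \<union> (?P \<union> ?Q))"
    using fin fins finE by (intro card_mono) (auto simp: image_iff)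
  also have "\<dots> \<le> card ?E + (card ?P + card ?Q)"
    by (rule order.trans[OF card_Un_le add_left_mono[OF card_Un_le]])
  finally show ?thesis using P Q by (simp add: distrib_left)
qed

text \<open>\<open>a\<close> is the main branch of a query and \<open>b\<close> the rare one, damped
  by \<open>w\<close>. Together they cost a factor \<open>1 + \<theta> \<le> exp \<theta>\<close>,
  which the drop of the exponent by \<theta> pays for.\<close>

lemma exp_query_step:
  fixes a b X \<theta> w :: real
  assumes "a \<le> exp (X - \<theta>)" "b \<le> w * exp (X - \<theta>)" "w \<le> \<theta>"
  shows "a + b \<le> exp X"
proof -
  have "b \<le> \<theta> * exp (X - \<theta>)"
    using assms by (meson exp_ge_zero mult_right_mono order_trans)
  then have "a + b \<le> (1 + \<theta>) * exp (X - \<theta>)"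
    using assms by (simp add: algebra_simps)
  also have "\<dots> \<le> exp \<theta> * exp (X - \<theta>)"
    by (intro mult_right_mono exp_ge_add_one_self) auto
  finally show ?thesis by (simp flip: exp_add)
qed

text \<open>From \<open>Min S + a = Max S + b\<close> follow \<open>a = Max S\<close> and
  \<open>b = Min S\<close>, so the two translates share a single point.\<close>

lemma two_translates_card:
  fixes S :: "nat set"
  assumes "finite S" "S \<noteq> {}"
  shows "card ((+) (Min S) ` S \<union> (+) (Max S) ` S) = 2 * card S - 1"
proof -
  have "(+) (Min S) ` S \<inter> (+) (Max S) ` S = {Min S + Max S}"
  proof (rule set_eqI, rule iffI)
    fix z assume "z \<in> (+) (Min S) ` S \<inter> (+) (Max S) ` S"
    then obtain a b where ab: "a \<in> S" "b \<in> S" "z = Min S + a" "z = Max S + b" by auto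
    then have "a \<le> Max S" "Min S \<le> b" using assms by auto
    then show "z \<in> {Min S + Max S}" using ab by auto
  next
    fix z assume "z \<in> {Min S + Max S}"
    then show "z \<in> (+) (Min S) ` S \<inter> (+) (Max S) ` S"
      using assms by (auto simp: image_iff add.commute)
  qed
  moreover have "card ((+) x ` S) = card S" for x :: nat
    by (intro card_image) auto
  ultimately show ?thesis
    using card_Un_Int[of "(+) (Min S) ` S" "(+) (Max S) ` S"] assms by simp
qed

section \<open>Weighted sums and the three kinds of queries\<close>

text \<open>\<open>F\<close> is the fingerprint of elements already known to lie in the random set, \<open>S\<close> the undetermined elements, \<open>U\<close> the sums not yet accounted for.\<close>

definition weighted_sumset :: "real \<Rightarrow> real \<Rightarrow> nat set \<Rightarrow> nat set \<Rightarrow> nat set \<Rightarrow> real" where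
  "weighted_sumset p \<kappa> F S U = ev p S (\<lambda>A. exp (- \<kappa> * card (U \<inter> (A + (A \<union> F)))))"

definition incidences :: "nat set \<Rightarrow> nat set \<Rightarrow> nat set \<Rightarrow> nat" where
  "incidences F S U = card {(y, u). y \<in> S \<and> u \<in> U \<and> (\<exists>f\<in>F. u = y + f)}"

text \<open>If \<open>y\<close> is chosen, all of \<open>Y\<close> occurs among the sums and pays
  \<open>exp (- \<kappa>)\<close> per element. Then \<open>y\<close> is discarded rather than added
  to \<open>F\<close>: its sums with other chosen elements are ignored, which can only increase the
  weight.\<close>

lemma weighted_sumset_query:
  fixes S U F :: "nat set"
  assumes p: "0 < p" "p < 1" and \<kappa>: "\<kappa> \<ge> 0" and fin: "finite S" "finite U" and y: "y \<in> S"
  defines "Y \<equiv> {u \<in> U. \<exists>f\<in>F. u = y + f}"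
  shows "weighted_sumset p \<kappa> F S U
    \<le> (1 - p) * weighted_sumset p \<kappa> F (S - {y}) U
      + p * (exp (- \<kappa> * card Y) * weighted_sumset p \<kappa> F (S - {y}) (U - Y))"
proof -
  let ?g = "\<lambda>A. exp (- \<kappa> * card (U \<inter> (A + (A \<union> F))))"
  have "ev p (S - {y}) (\<lambda>A. ?g (insert y A))
      \<le> ev p (S - {y}) (\<lambda>A. exp (- \<kappa> * card Y) * exp (- \<kappa> * card ((U - Y) \<inter> (A + (A \<union> F)))))"
  proof (rule ev_mono)
    fix A assume "A \<subseteq> S - {y}"
    let ?T = "insert y A + (insert y A \<union> F)"
    have "Y \<union> (U - Y) \<inter> (A + (A \<union> F)) \<subseteq> U \<inter> ?T"
      by (auto simp: Y_def set_plus_def)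
    then have "card (Y \<union> (U - Y) \<inter> (A + (A \<union> F))) \<le> card (U \<inter> ?T)"
      using fin by (intro card_mono) auto
    moreover have "card (Y \<union> (U - Y) \<inter> (A + (A \<union> F))) = card Y + card ((U - Y) \<inter> (A + (A \<union> F)))"
      using fin by (intro card_Un_disjoint) (auto simp: Y_def)
    ultimately have "real (card Y) + real (card ((U - Y) \<inter> (A + (A \<union> F)))) \<le> real (card (U \<inter> ?T))"
      by linarith
    then have "\<kappa> * (real (card Y) + real (card ((U - Y) \<inter> (A + (A \<union> F))))) \<le> \<kappa> * card (U \<inter> ?T)"
      using \<kappa> by (rule mult_left_mono)
    then show "?g (insert y A) \<le> exp (- \<kappa> * card Y) * exp (- \<kappa> * card ((U - Y) \<inter> (A + (A \<union> F))))"
      by (simp add: algebra_simps flip: exp_add)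
  qed (use p in auto)
  also have "\<dots> = exp (- \<kappa> * card Y) * weighted_sumset p \<kappa> F (S - {y}) (U - Y)"
    by (simp add: ev_cmult weighted_sumset_def)
  finally show ?thesis
    unfolding weighted_sumset_def[of p \<kappa> F S U] using p fin y
    by (subst ev_remove[of S y]) (auto simp: weighted_sumset_def intro!: mult_left_mono)
qed

text \<open>Pointwise, \<open>u\<close> occurs as soon as \<open>A\<close> meets \<open>Q\<close>;
  otherwise the two coefficients add up to \<open>1\<close>. In this form the first term needs no
  conditioning on \<open>A\<close>, and the second keeps the probability of avoiding
  \<open>Q\<close>.\<close>

lemma weighted_sumset_query_target:
  fixes S U F :: "nat set"
  assumes p: "0 < p" "p < 1" and \<kappa>: "\<kappa> \<ge> 0" and fin: "finite S" "finite U" and u: "u \<in> U"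
  defines "Q \<equiv> {y \<in> S. \<exists>f\<in>F. u = y + f}"
  shows "weighted_sumset p \<kappa> F S U
    \<le> exp (- \<kappa>) * weighted_sumset p \<kappa> F S (U - {u})
      + (1 - exp (- \<kappa>)) * ((1 - p) ^ card Q * weighted_sumset p \<kappa> F (S - Q) (U - {u}))"
proof -
  let ?h = "\<lambda>A. exp (- \<kappa> * card ((U - {u}) \<inter> (A + (A \<union> F))))"
  have "weighted_sumset p \<kappa> F S U
      \<le> ev p S (\<lambda>A. exp (- \<kappa>) * ?h A + (1 - exp (- \<kappa>)) * (if A \<inter> Q = {} then ?h A else 0))"
    unfolding weighted_sumset_def
  proof (rule ev_mono)
    fix A assume A: "A \<subseteq> S"
    let ?T = "A + (A \<union> F)"
    show "exp (- \<kappa> * card (U \<inter> ?T)) \<le> exp (- \<kappa>) * ?h A + (1 - exp (- \<kappa>)) * (if A \<inter> Q = {} then ?h A else 0)"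
    proof (cases "A \<inter> Q = {}")
      case True
      have "card ((U - {u}) \<inter> ?T) \<le> card (U \<inter> ?T)"
        using fin by (intro card_mono) auto
      then have "\<kappa> * real (card ((U - {u}) \<inter> ?T)) \<le> \<kappa> * real (card (U \<inter> ?T))"
        using \<kappa> by (intro mult_left_mono) auto
      then have "exp (- \<kappa> * card (U \<inter> ?T)) \<le> ?h A" by simp
      then show ?thesis using True by (simp add: algebra_simps)
    next
      case False
      then obtain y where "y \<in> A" "y \<in> Q" by auto
      then have "u \<in> ?T" by (auto simp: Q_def set_plus_def)
      then have "U \<inter> ?T = insert u ((U - {u}) \<inter> ?T)" using u by auto
      then have "card (U \<inter> ?T) = Suc (card ((U - {u}) \<inter> ?T))"
        using fin by simp
      then show ?thesis using False by (simp add: algebra_simps flip: exp_add)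
    qed
  qed (use p in auto)
  also have "\<dots> = exp (- \<kappa>) * weighted_sumset p \<kappa> F S (U - {u})
      + (1 - exp (- \<kappa>)) * ((1 - p) ^ card Q * weighted_sumset p \<kappa> F (S - Q) (U - {u}))"
    unfolding ev_add ev_cmult using fin
    by (subst ev_avoid) (auto simp: Q_def weighted_sumset_def)
  finally show ?thesis .
qed

text \<open>A chosen \<open>x\<close> moves to the fingerprint: its sums with chosen elements of
  \<open>S - {x}\<close> stay visible through \<open>F\<close>, while those with itself and with the
  old \<open>F\<close> are forgotten.\<close>

lemma weighted_sumset_query_extend:
  fixes S U F :: "nat set"
  assumes p: "0 < p" "p < 1" and \<kappa>: "\<kappa> \<ge> 0" and fin: "finite S" "finite U" and x: "x \<in> S"
  shows "weighted_sumset p \<kappa> F S U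
    \<le> (1 - p) * weighted_sumset p \<kappa> F (S - {x}) U + p * weighted_sumset p \<kappa> (insert x F) (S - {x}) U"
proof -
  let ?g = "\<lambda>A. exp (- \<kappa> * card (U \<inter> (A + (A \<union> F))))"
  have "ev p (S - {x}) (\<lambda>A. ?g (insert x A)) \<le> weighted_sumset p \<kappa> (insert x F) (S - {x}) U"
    unfolding weighted_sumset_def
  proof (rule ev_mono)
    fix A assume "A \<subseteq> S - {x}"
    have "A + (A \<union> insert x F) \<subseteq> insert x A + (insert x A \<union> F)"
      by (auto simp: set_plus_def)
    then have "card (U \<inter> (A + (A \<union> insert x F))) \<le> card (U \<inter> (insert x A + (insert x A \<union> F)))"
      using fin by (intro card_mono) auto
    then have "\<kappa> * real (card (U \<inter> (A + (A \<union> insert x F)))) \<le> \<kappa> * real (card (U \<inter> (insert x A + (insert x A \<union> F))))"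
      using \<kappa> by (intro mult_left_mono) auto
    then show "?g (insert x A) \<le> exp (- \<kappa> * card (U \<inter> (A + (A \<union> insert x F))))"
      by simp
  qed (use p in auto)
  then show ?thesis
    unfolding weighted_sumset_def[of p \<kappa> F] using p fin x
    by (subst ev_remove[of S x]) (auto intro!: mult_left_mono)
qed

section \<open>Changes of the edge count\<close>

lemma incidences_remove:
  assumes "finite S" "finite U" "S' \<subseteq> S" "U' \<subseteq> U"
    and "\<And>y. y \<in> S \<Longrightarrow> card {u \<in> U. \<exists>f\<in>F. u = y + f} \<le> G"
    and "\<And>u. u \<in> U \<Longrightarrow> card {y \<in> S. \<exists>f\<in>F. u = y + f} \<le> G"
  shows "incidences F S U \<le> incidences F (S - S') (U - U') + G * (card S' + card U')"
  unfolding incidences_def by (rule card_incidence_remove[OF assms])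

text \<open>Each \<open>u\<close> in \<open>U\<close> and \<open>x + S\<close> gives an edge from
  \<open>u - x\<close>, new because \<open>x\<close> was not in \<open>F\<close>. One is lost for
  \<open>u = x + x\<close>, whose source \<open>x\<close> has left \<open>S\<close>.\<close>

lemma incidences_extend:
  fixes S U F :: "nat set"
  assumes fin: "finite S" "finite U" and x: "x \<in> S" "x \<notin> F"
    and D: "D \<le> card ((+) x ` S \<inter> U)"
  shows "incidences F (S - {x}) U + (D - 1) \<le> incidences (insert x F) (S - {x}) U"
proof -
  let ?E = "{(y, u). y \<in> S - {x} \<and> u \<in> U \<and> (\<exists>f\<in>F. u = y + f)}"
  let ?E' = "{(y, u). y \<in> S - {x} \<and> u \<in> U \<and> (\<exists>f\<in>insert x F. u = y + f)}"
  let ?N = "(\<lambda>u. (u - x, u)) ` (((+) x ` S \<inter> U) - {x + x})"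
  have fin': "finite ?E'" "finite ?E" "finite ?N"
    using fin by (auto intro: finite_subset[of _ "S \<times> U"])
  have "card ?N = card (((+) x ` S \<inter> U) - {x + x})"
    by (intro card_image inj_onI) auto
  moreover have "card ((+) x ` S \<inter> U) - card {x + x} \<le> card (((+) x ` S \<inter> U) - {x + x})"
    by (rule diff_card_le_card_Diff) auto
  ultimately have "D - 1 \<le> card ?N" using D by simp
  moreover have "card ?E + card ?N = card (?E \<union> ?N)"
    using fin' x by (intro card_Un_disjoint[symmetric]) auto
  moreover have "card (?E \<union> ?N) \<le> card ?E'"
    using fin' by (intro card_mono) auto
  ultimately show ?thesis unfolding incidences_def by linarith
qed

section \<open>The induction over queries\<close>

lemma real_card_Diff:
  assumes "finite B" "A \<subseteq> B"
  shows "real (card (B - A)) = real (card B) - real (card A)"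
  using assms by (simp add: card_Diff_subset finite_subset card_mono of_nat_diff)

text \<open>
  The potential \<open>(\<theta> + \<rho>G)(|S| + |U|) - \<rho> \<cdot> incidences\<close> never increases when vertices of degree at most
  \<open>G\<close> are deleted, whatever the order of deletion. A positive answer at a vertex of degree \<open>G\<close> deletes \<open>G\<close>
  vertices (gain \<open>\<theta>G\<close>), and one at an extreme point of \<open>S\<close> adds \<open>D - 1\<close> incidences (gain \<open>\<rho>(D - 1)\<close>).
\<close>

lemma weighted_sumset_bound:
  fixes p \<kappa> \<theta> \<rho> :: real and N G D :: nat
  assumes p: "0 < p" "p \<le> 1 / 2" and \<kappa>: "1 - p = exp (- 2 * \<kappa>)"
    and \<theta>: "0 < \<theta>" and \<rho>: "0 < \<rho>" and D: "0 < D"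
    and G_large: "2 * p * exp (- \<theta> * G) \<le> \<theta>"
    and D_large: "2 * p * exp (- \<rho> * (D - 1)) \<le> \<theta>"
    and "S \<subseteq> {1..N}" "U \<subseteq> {1..2 * N}" "finite F" "F \<inter> S = {}"
    and "\<And>y. y \<in> S \<Longrightarrow> card {u \<in> U. \<exists>f\<in>F. u = y + f} \<le> G"
    and "\<And>u. u \<in> U \<Longrightarrow> card {y \<in> S. \<exists>f\<in>F. u = y + f} \<le> G"
  shows "weighted_sumset p \<kappa> F S U
    \<le> exp ((\<theta> + \<rho> * G) * (card S + card U) - \<rho> * incidences F S U
         - \<kappa> * (2 * real (card S) + card U - 2 * N - 2 * D - 1))"
  using assms(9-)
proof (induction "card S + card U" arbitrary: S U F rule: less_induct)
  case less
  note SU = less.prems(1,2) and F = less.prems(3,4) and degS = less.prems(5) and degU = less.prems(6)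
  have fin: "finite S" "finite U" using SU finite_subset by auto
  have p1: "0 < p" "p < 1" using p by auto
  have \<kappa>0: "\<kappa> > 0"
  proof -
    have "exp (- 2 * \<kappa>) < exp 0" using p unfolding \<kappa>[symmetric] by simp
    then show ?thesis unfolding exp_less_cancel_iff by simp
  qed
  \<comment> \<open>A chosen element is deleted from \<open>S\<close> without earning the factor
    \<open>exp (- 2 * \<kappa>)\<close> of a forbidden one. The loss
    \<open>exp (2 * \<kappa>)\<close> is at most \<open>2\<close>.\<close>
  have odds: "p * exp (2 * \<kappa>) \<le> 2 * p"
  proof -
    have "exp (2 * \<kappa>) * (1 - p) = 1" unfolding \<kappa> by (simp flip: exp_add)
    moreover have "exp (2 * \<kappa>) * (1 / 2) \<le> exp (2 * \<kappa>) * (1 - p)"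
      using p by (intro mult_left_mono) auto
    ultimately have "exp (2 * \<kappa>) \<le> 2" by linarith
    then show ?thesis using p by (auto simp: mult.commute)
  qed
  have odds': "exp \<kappa> - 1 \<le> 2 * p"
  proof -
    have "exp \<kappa> \<le> exp (2 * \<kappa>)" using \<kappa>0 by simp
    moreover have "exp (2 * \<kappa>) * (1 - p) = 1" unfolding \<kappa> by (simp flip: exp_add)
    ultimately have "exp \<kappa> \<le> 1 + p * exp (2 * \<kappa>)" by (simp add: algebra_simps)
    then show ?thesis using odds by linarith
  qed
  define \<Psi> where "\<Psi> F S U = (\<theta> + \<rho> * G) * (card S + card U) - \<rho> * incidences F S U" for F S U
  define c where "c = 2 * real N + 2 * D + 1"
  \<comment> \<open>The exponent of the claim. The weights 2 of \<open>S\<close> and 1 of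
    \<open>U\<close> match the factors \<open>1 - p = exp (- 2 * \<kappa>)\<close> for a forbidden
    element and \<open>exp (- \<kappa>)\<close> for a sum that occurs.\<close>
  define X where "X F S U = \<Psi> F S U - \<kappa> * (2 * real (card S) + card U - c)" for F S U
  have remove: "\<Psi> F (S - S') (U - U') \<le> \<Psi> F S U - \<theta> * (card S' + card U')"
    if "S' \<subseteq> S" "U' \<subseteq> U" for S' U'
  proof -
    have card: "card (S - S') = card S - card S'" "card (U - U') = card U - card U'"
      "card S' \<le> card S" "card U' \<le> card U"
      using that fin by (auto intro!: card_Diff_subset card_mono intro: finite_subset)
    have "real (incidences F S U) \<le> real (incidences F (S - S') (U - U') + G * (card S' + card U'))"
      using incidences_remove[OF fin that degS degU] by (simp only: of_nat_le_iff)
    then have "\<rho> * incidences F S U \<le> \<rho> * (incidences F (S - S') (U - U') + G * (card S' + card U'))"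
      using \<rho> by simp
    then show ?thesis
      unfolding \<Psi>_def card using card by (simp add: of_nat_diff algebra_simps)
  qed
  have IH: "weighted_sumset p \<kappa> F (S - S') (U - U') \<le> exp (X F (S - S') (U - U'))"
    if "S' \<subseteq> S" "U' \<subseteq> U" "S' \<noteq> {} \<or> U' \<noteq> {}" for S' U'
    unfolding X_def \<Psi>_def c_def
  proof (rule order.trans[OF less.hyps])
    have "card (S - S') \<le> card S" "card (U - U') \<le> card U"
      using fin by (auto intro: card_mono)
    moreover have "card (S - S') < card S \<or> card (U - U') < card U"
      using that fin by (auto intro!: psubset_card_mono)
    ultimately show "card (S - S') + card (U - U') < card S + card U" by linarith
    show "card {u \<in> U - U'. \<exists>f\<in>F. u = y + f} \<le> G" if "y \<in> S - S'" for y
      using fin that by (intro order.trans[OF card_mono degS]) auto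
    show "card {y \<in> S - S'. \<exists>f\<in>F. u = y + f} \<le> G" if "u \<in> U - U'" for u
      using fin that by (intro order.trans[OF card_mono degU]) auto
  qed (use SU F in \<open>auto simp: algebra_simps\<close>)
  have goal: "weighted_sumset p \<kappa> F S U \<le> exp (X F S U)"
  proof -
    \<comment> \<open>Vertices of degree \<open>G\<close> are queried first, so in
      \<open>extend\<close> all degrees are below \<open>G\<close> and remain at most
      \<open>G\<close> once \<open>x\<close> joins \<open>F\<close>. Any element of \<open>S\<close>
      may extend; the extremes of \<open>S\<close> matter only in \<open>stop\<close>.\<close>
    consider (source) y where "y \<in> S" "card {u \<in> U. \<exists>f\<in>F. u = y + f} = G"
      | (target) u where "u \<in> U" "card {y \<in> S. \<exists>f\<in>F. u = y + f} = G"
      | (extend) x where "x \<in> S" "D \<le> card ((+) x ` S \<inter> U)"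
          "\<And>y. y \<in> S \<Longrightarrow> card {u \<in> U. \<exists>f\<in>F. u = y + f} < G"
          "\<And>u. u \<in> U \<Longrightarrow> card {y \<in> S. \<exists>f\<in>F. u = y + f} < G"
      | (stop) "\<And>x. x \<in> S \<Longrightarrow> card ((+) x ` S \<inter> U) < D"
      using degS degU by (meson le_neq_implies_less not_le)
    then show ?thesis
    proof cases
      case source
      define Y where "Y = {u \<in> U. \<exists>f\<in>F. u = y + f}"
      have Y: "Y \<subseteq> U" "card Y = G" using source by (auto simp: Y_def)
      have cards: "real (card (S - {y})) = real (card S) - 1" "real (card (U - Y)) = real (card U) - G"
        using source(1) real_card_Diff[OF fin(1), of "{y}"] real_card_Diff[OF fin(2) Y(1)] Y(2) by auto
      \<comment> \<open>Negative answer: \<open>1 - p\<close> pays exactly for the loss of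
        \<open>y\<close> from the term \<open>2|S|\<close>, and the potential drops by
        \<theta>.\<close>
      have a: "(1 - p) * weighted_sumset p \<kappa> F (S - {y}) U \<le> exp (X F S U - \<theta>)"
      proof -
        have "(1 - p) * weighted_sumset p \<kappa> F (S - {y}) U \<le> (1 - p) * exp (X F (S - {y}) U)"
          using IH[of "{y}" "{}"] source(1) p by (intro mult_left_mono) auto
        also have "\<dots> = exp (X F (S - {y}) U - 2 * \<kappa>)"
          unfolding \<kappa> by (simp add: algebra_simps flip: exp_add)
        also have "\<dots> \<le> exp (X F S U - \<theta>)"
          using remove[of "{y}" "{}"] source(1) unfolding X_def cards by (simp add: algebra_simps)
        finally show ?thesis .
      qed
      \<comment> \<open>Positive answer: \<open>Y\<close> pays for itself and \<open>y\<close> does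
        not, while the \<open>G + 1\<close> deleted vertices lower the potential by
        \<open>\<theta> * (G + 1)\<close>.\<close>
      have b: "p * (exp (- \<kappa> * card Y) * weighted_sumset p \<kappa> F (S - {y}) (U - Y))
          \<le> (2 * p * exp (- \<theta> * G)) * exp (X F S U - \<theta>)"
      proof -
        have "p * (exp (- \<kappa> * card Y) * weighted_sumset p \<kappa> F (S - {y}) (U - Y))
            \<le> p * (exp (- \<kappa> * card Y) * exp (X F (S - {y}) (U - Y)))"
          using IH[of "{y}" Y] source(1) p Y by (intro mult_left_mono) auto
        also have "\<dots> = p * exp (X F (S - {y}) (U - Y) - \<kappa> * G)"
          by (simp add: Y algebra_simps flip: exp_add)
        also have "\<dots> \<le> p * exp (2 * \<kappa> - \<theta> * G + (X F S U - \<theta>))"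
          using remove[of "{y}" Y] source(1) Y p unfolding X_def cards by (simp add: algebra_simps)
        also have "\<dots> = (p * exp (2 * \<kappa>)) * (exp (- \<theta> * G) * exp (X F S U - \<theta>))"
          by (simp add: mult.assoc exp_add exp_diff exp_minus divide_simps)
        also have "\<dots> \<le> (2 * p) * (exp (- \<theta> * G) * exp (X F S U - \<theta>))"
          by (rule mult_right_mono[OF odds]) auto
        finally show ?thesis by (simp add: mult.assoc)
      qed
      show ?thesis
        using weighted_sumset_query[OF p1 less_imp_le[OF \<kappa>0] fin source(1), of F]
          exp_query_step[OF a b G_large] unfolding Y_def by linarith
    next
      case target
      define Q where "Q = {y \<in> S. \<exists>f\<in>F. u = y + f}"
      have Q: "Q \<subseteq> S" "card Q = G" using target by (auto simp: Q_def)
      have cards: "real (card (U - {u})) = real (card U) - 1" "real (card (S - Q)) = real (card S) - G"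
        using target(1) real_card_Diff[OF fin(2), of "{u}"] real_card_Diff[OF fin(1) Q(1)] Q(2) by auto
      have a: "exp (- \<kappa>) * weighted_sumset p \<kappa> F S (U - {u}) \<le> exp (X F S U - \<theta>)"
      proof -
        have "exp (- \<kappa>) * weighted_sumset p \<kappa> F S (U - {u}) \<le> exp (- \<kappa>) * exp (X F S (U - {u}))"
          using IH[of "{}" "{u}"] target(1) by (intro mult_left_mono) auto
        also have "\<dots> = exp (X F S (U - {u}) - \<kappa>)"
          by (simp add: algebra_simps flip: exp_add)
        also have "\<dots> \<le> exp (X F S U - \<theta>)"
          using remove[of "{}" "{u}"] target(1) unfolding X_def cards by (simp add: algebra_simps)
        finally show ?thesis .
      qed
      have pow: "(1 - p) ^ card Q = exp (- 2 * \<kappa> * G)"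
        unfolding \<kappa> Q(2) by (simp add: mult_ac flip: exp_of_nat_mult)
      \<comment> \<open>The rare branch is now that \<open>A\<close> avoids \<open>Q\<close>. The
        \<open>G\<close> forbidden elements pay for themselves, only \<open>u\<close> is deleted
        unpaid, and the factor left is \<open>exp \<kappa> - 1\<close>.\<close>
      have b: "(1 - exp (- \<kappa>)) * ((1 - p) ^ card Q * weighted_sumset p \<kappa> F (S - Q) (U - {u}))
          \<le> (2 * p * exp (- \<theta> * G)) * exp (X F S U - \<theta>)"
      proof -
        have "(1 - exp (- \<kappa>)) * (exp (- 2 * \<kappa> * G) * weighted_sumset p \<kappa> F (S - Q) (U - {u}))
            \<le> (1 - exp (- \<kappa>)) * (exp (- 2 * \<kappa> * G) * exp (X F (S - Q) (U - {u})))"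
          using IH[of Q "{u}"] target(1) p Q \<kappa>0 by (intro mult_left_mono) auto
        also have "exp (- 2 * \<kappa> * G) * exp (X F (S - Q) (U - {u})) = exp (X F (S - Q) (U - {u}) - 2 * \<kappa> * G)"
          by (simp add: algebra_simps flip: exp_add)
        also have "(1 - exp (- \<kappa>)) * \<dots> \<le> (1 - exp (- \<kappa>)) * exp (\<kappa> - \<theta> * G + (X F S U - \<theta>))"
          using remove[of Q "{u}"] target(1) Q \<kappa>0
          unfolding X_def cards by (intro mult_left_mono) (auto simp: algebra_simps)
        also have "\<dots> = ((1 - exp (- \<kappa>)) * exp \<kappa>) * (exp (- \<theta> * G) * exp (X F S U - \<theta>))"
          by (simp add: mult.assoc exp_add exp_diff exp_minus divide_simps)
        also have "(1 - exp (- \<kappa>)) * exp \<kappa> = exp \<kappa> - 1"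
          by (simp add: algebra_simps flip: exp_add)
        also have "(exp \<kappa> - 1) * (exp (- \<theta> * G) * exp (X F S U - \<theta>))
            \<le> (2 * p) * (exp (- \<theta> * G) * exp (X F S U - \<theta>))"
          by (rule mult_right_mono[OF odds']) auto
        finally show ?thesis unfolding pow by (simp add: mult.assoc)
      qed
      show ?thesis
        using weighted_sumset_query_target[OF p1 less_imp_le[OF \<kappa>0] fin target(1), of F]
          exp_query_step[OF a b G_large] unfolding Q_def by linarith
    next
      case extend
      have cards: "real (card (S - {x})) = real (card S) - 1" "card (S - {x}) < card S"
        using extend(1) fin real_card_Diff[OF fin(1), of "{x}"] by (auto intro: card_Diff1_less)
      have xF: "x \<notin> F" using extend(1) F by auto
      have a: "(1 - p) * weighted_sumset p \<kappa> F (S - {x}) U \<le> exp (X F S U - \<theta>)"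
      proof -
        have "(1 - p) * weighted_sumset p \<kappa> F (S - {x}) U \<le> (1 - p) * exp (X F (S - {x}) U)"
          using IH[of "{x}" "{}"] extend(1) p by (intro mult_left_mono) auto
        also have "\<dots> = exp (X F (S - {x}) U - 2 * \<kappa>)"
          unfolding \<kappa> by (simp add: algebra_simps flip: exp_add)
        also have "\<dots> \<le> exp (X F S U - \<theta>)"
          using remove[of "{x}" "{}"] extend(1) unfolding X_def cards(1) by (simp add: algebra_simps)
        finally show ?thesis .
      qed
      have IH': "weighted_sumset p \<kappa> (insert x F) (S - {x}) U \<le> exp (X (insert x F) (S - {x}) U)"
        unfolding X_def \<Psi>_def c_def
      proof (rule order.trans[OF less.hyps])
        show "card {u \<in> U. \<exists>f\<in>insert x F. u = y + f} \<le> G" if "y \<in> S - {x}" for y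
        proof -
          have "card {u \<in> U. \<exists>f\<in>insert x F. u = y + f} \<le> card (insert (y + x) {u \<in> U. \<exists>f\<in>F. u = y + f})"
            using fin by (intro card_mono) auto
          also have "\<dots> \<le> Suc (card {u \<in> U. \<exists>f\<in>F. u = y + f})" by (rule card_insert_le_m1) auto
          finally show ?thesis using extend(3)[of y] that by simp
        qed
        show "card {y \<in> S - {x}. \<exists>f\<in>insert x F. u = y + f} \<le> G" if "u \<in> U" for u
        proof -
          have "card {y \<in> S - {x}. \<exists>f\<in>insert x F. u = y + f} \<le> card (insert (u - x) {y \<in> S. \<exists>f\<in>F. u = y + f})"
            using fin by (intro card_mono) auto
          also have "\<dots> \<le> Suc (card {y \<in> S. \<exists>f\<in>F. u = y + f})" by (rule card_insert_le_m1) auto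
          finally show ?thesis using extend(4)[of u] that by simp
        qed
      qed (use SU F cards in \<open>auto simp: algebra_simps\<close>)
      have \<Psi>': "\<Psi> (insert x F) (S - {x}) U \<le> \<Psi> F S U - \<theta> - \<rho> * (D - 1)"
      proof -
        have "real (incidences F (S - {x}) U + (D - 1)) \<le> real (incidences (insert x F) (S - {x}) U)"
          using incidences_extend[OF fin extend(1) xF extend(2)] by (simp only: of_nat_le_iff)
        then have "incidences F (S - {x}) U + (real D - 1) \<le> incidences (insert x F) (S - {x}) U"
          using D by (simp add: of_nat_diff)
        then have "\<rho> * (incidences F (S - {x}) U + (real D - 1)) \<le> \<rho> * incidences (insert x F) (S - {x}) U"
          using \<rho> by (intro mult_left_mono) auto
        then have "\<Psi> (insert x F) (S - {x}) U \<le> \<Psi> F (S - {x}) U - \<rho> * (real D - 1)"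
          unfolding \<Psi>_def by (simp add: algebra_simps)
        then show ?thesis using remove[of "{x}" "{}"] extend(1) D by (simp add: of_nat_diff)
      qed
      have b: "p * weighted_sumset p \<kappa> (insert x F) (S - {x}) U
          \<le> (2 * p * exp (- \<rho> * (D - 1))) * exp (X F S U - \<theta>)"
      proof -
        have "p * weighted_sumset p \<kappa> (insert x F) (S - {x}) U \<le> p * exp (X (insert x F) (S - {x}) U)"
          using IH' p by (intro mult_left_mono) auto
        also have "\<dots> \<le> p * exp (2 * \<kappa> - \<rho> * (D - 1) + (X F S U - \<theta>))"
          using \<Psi>' p unfolding X_def cards(1) by (simp add: algebra_simps)
        also have "\<dots> = (p * exp (2 * \<kappa>)) * (exp (- \<rho> * (D - 1)) * exp (X F S U - \<theta>))"
          by (simp add: mult.assoc exp_add exp_diff exp_minus divide_simps)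
        also have "\<dots> \<le> (2 * p) * (exp (- \<rho> * (D - 1)) * exp (X F S U - \<theta>))"
          by (rule mult_right_mono[OF odds]) auto
        finally show ?thesis by (simp add: mult.assoc)
      qed
      show ?thesis
        using weighted_sumset_query_extend[OF p1 less_imp_le[OF \<kappa>0] fin extend(1), of F]
          exp_query_step[OF a b D_large] by linarith
    next
      case stop
      \<comment> \<open>At a stop the weighted sum is bounded by \<open>1\<close>, so the exponent
        only has to be nonnegative. The two extreme translates hold \<open>2|S| - 1\<close> sums in
        \<open>[2N]\<close>, and fewer than \<open>2D\<close> of these lie in
        \<open>U\<close>.\<close>
      have "2 * real (card S) + card U \<le> c"
      proof (cases "S = {}")
        case True
        have "card U \<le> card {1..2 * N}" using SU by (intro card_mono) auto
        then show ?thesis using True by (simp add: c_def)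
      next
        case False
        have MM: "Min S \<in> S" "Max S \<in> S" using fin False by auto
        let ?T = "(+) (Min S) ` S \<union> (+) (Max S) ` S"
        have "?T \<subseteq> {1..2 * N}"
        proof
          fix t assume "t \<in> ?T"
          then obtain a b where "a \<in> S" "b \<in> S" "t = a + b" using MM by auto
          then have "1 \<le> a" "a \<le> N" "1 \<le> b" "b \<le> N" using SU by auto
          then show "t \<in> {1..2 * N}" using \<open>t = a + b\<close> by auto
        qed
        then have "card (U \<union> ?T) \<le> card {1..2 * N}" using SU by (intro card_mono) auto
        moreover have "card U + card ?T = card (U \<union> ?T) + card (U \<inter> ?T)"
          using fin by (intro card_Un_Int) auto
        moreover have "card (U \<inter> ?T) \<le> card ((+) (Min S) ` S \<inter> U) + card ((+) (Max S) ` S \<inter> U)"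
          by (rule order.trans[OF card_mono card_Un_le]) (use fin in auto)
        moreover have "card ?T = 2 * card S - 1" "card S > 0"
          using two_translates_card fin False by (auto simp: card_gt_0_iff)
        ultimately have "2 * card S + card U \<le> 2 * N + 2 * D + 1"
          using stop[OF MM(1)] stop[OF MM(2)] by auto
        then have "real (2 * card S + card U) \<le> real (2 * N + 2 * D + 1)" by (simp only: of_nat_le_iff)
        then show ?thesis unfolding c_def by simp
      qed
      then have "\<kappa> * (2 * real (card S) + card U - c) \<le> 0"
        using \<kappa>0 by (simp add: mult_le_0_iff)
      \<comment> \<open>Deleting every vertex never raises the potential and ends at
        \<open>0\<close>.\<close>
      moreover have "0 \<le> \<Psi> F S U"
        using remove[of S U] \<theta> fin
        by (simp add: \<Psi>_def incidences_def) (smt (verit) mult_nonneg_nonneg of_nat_0_le_iff add_nonneg_nonneg)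
      ultimately have "0 \<le> X F S U" by (simp add: X_def)
      moreover have "weighted_sumset p \<kappa> F S U \<le> ev p S (\<lambda>A. 1)"
        unfolding weighted_sumset_def using p \<kappa>0 by (intro ev_mono) auto
      ultimately show ?thesis
        using fin by (simp add: ev_const) (smt (verit) one_le_exp_iff)
    qed
  qed
  then show ?case by (simp add: X_def \<Psi>_def c_def algebra_simps)
qed

text \<open>Exponential Markov inequality: \<open>m\<close> missing sums leave at most
  \<open>2N - m\<close> that occur. The queries start from \<open>F = {}\<close>,
  \<open>S = [N]\<close>, \<open>U = [2N]\<close>, so that \<open>|S| + |U| = 3N\<close>, and
  \<open>2|S| + |U| - 2N = 2N\<close> cancels the \<open>2N\<close> coming from Markov.\<close>

lemma prob_many_missing_le:
  fixes p \<kappa> \<theta> \<rho> :: real and N G D m :: nat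
  assumes p: "0 < p" "p \<le> 1 / 2" and \<kappa>: "1 - p = exp (- 2 * \<kappa>)"
    and "0 < \<theta>" "0 < \<rho>" "0 < D"
    and "2 * p * exp (- \<theta> * G) \<le> \<theta>"
    and "2 * p * exp (- \<rho> * (D - 1)) \<le> \<theta>"
  shows "ev p {1..N} (indicator {A. m \<le> card ({1..2 * N} - (A + A))})
    \<le> exp (3 * N * (\<theta> + \<rho> * G) - \<kappa> * (real m - 2 * D - 1))"
proof -
  have "exp (- 2 * \<kappa>) < exp 0" using p unfolding \<kappa>[symmetric] by simp
  then have \<kappa>0: "\<kappa> > 0" unfolding exp_less_cancel_iff by simp
  let ?U = "{1..2 * N}"
  have "ev p {1..N} (indicator {A. m \<le> card (?U - (A + A))})
      \<le> ev p {1..N} (\<lambda>A. exp (\<kappa> * (2 * real N - m)) * exp (- \<kappa> * card (?U \<inter> (A + (A \<union> {})))))"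
  proof (rule ev_mono)
    fix A :: "nat set"
    show "indicator {A. m \<le> card (?U - (A + A))} A
      \<le> exp (\<kappa> * (2 * real N - m)) * exp (- \<kappa> * card (?U \<inter> (A + (A \<union> {}))))"
    proof (cases "m \<le> card (?U - (A + A))")
      case True
      have "card (?U - (A + A)) + card (?U \<inter> (A + A)) = card ?U"
        by (subst card_Un_disjoint[symmetric]) (auto simp: Un_Diff_Int)
      then have "m + card (?U \<inter> (A + A)) \<le> 2 * N" using True by simp
      then have "real (m + card (?U \<inter> (A + A))) \<le> real (2 * N)" by (simp only: of_nat_le_iff)
      then have "\<kappa> * (m + card (?U \<inter> (A + A))) \<le> \<kappa> * (2 * N)"
        using \<kappa>0 by (intro mult_left_mono) auto
      then show ?thesis by (simp add: algebra_simps indicator_def flip: exp_add)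
    qed (simp add: indicator_def)
  qed (use p in auto)
  also have "\<dots> = exp (\<kappa> * (2 * real N - m)) * weighted_sumset p \<kappa> {} {1..N} ?U"
    by (simp add: ev_cmult weighted_sumset_def)
  also have "\<dots> \<le> exp (\<kappa> * (2 * real N - m)) * exp ((\<theta> + \<rho> * G) * (card {1..N} + card ?U)
      - \<rho> * incidences {} {1..N} ?U - \<kappa> * (2 * real (card {1..N}) + card ?U - 2 * N - 2 * D - 1))"
    by (intro mult_left_mono weighted_sumset_bound[OF assms]) auto
  also have "\<dots> = exp (3 * N * (\<theta> + \<rho> * G) - \<kappa> * (real m - 2 * D - 1))"
    by (simp add: incidences_def algebra_simps flip: exp_add)
  finally show ?thesis .
qed

section \<open>Missing sums in the middle\<close>

lemma independence_step:
  fixes p x :: real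
  assumes "0 < p" "p \<le> 1 / 2" "0 \<le> x" "x \<le> 1"
  shows "(1 - p) * exp (p * x / 8) + p * exp (- (13 * x / 16)) \<le> 1"
proof -
  \<comment> \<open>Below, \<open>x\<close> is \<open>p\<close> times the degree of an exposed
    vertex. The number \<open>13/16\<close> is \<open>1 - 3/16\<close>, where \<open>3x/16\<close>
    bounds the weight of the edges lost when a chosen vertex is deleted with its neighbours.\<close>
  have px: "0 \<le> p * x" "p * x \<le> 1 / 2 * 1" using assms mult_mono[of p "1 / 2" x 1] by auto
  have 1: "exp (p * x / 8) \<le> 1 + p * x / 4"
    using real_exp_bound_lemma[of "p * x / 8"] px by simp
  have "exp (- (13 * x / 16)) * (1 + 13 * x / 16) \<le> exp (- (13 * x / 16)) * exp (13 * x / 16)"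
    by (intro mult_left_mono exp_ge_add_one_self) auto
  then have "exp (- (13 * x / 16)) * (1 + 13 * x / 16) \<le> 1"
    by (simp flip: exp_add)
  moreover have "1 \<le> (1 - x / 4) * (1 + 13 * x / 16)"
  proof -
    have "x * x \<le> x * 1" using assms by (intro mult_left_mono) auto
    then show ?thesis using assms by (simp add: algebra_simps)
  qed
  ultimately have "exp (- (13 * x / 16)) * (1 + 13 * x / 16) \<le> (1 - x / 4) * (1 + 13 * x / 16)"
    by linarith
  then have 2: "exp (- (13 * x / 16)) \<le> 1 - x / 4"
    by (rule mult_right_le_imp_le) (use assms in auto)
  have "(1 - p) * exp (p * x / 8) + p * exp (- (13 * x / 16)) \<le> (1 - p) * (1 + p * x / 4) + p * (1 - x / 4)"
    using assms 1 2 by (intro add_mono mult_left_mono) auto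
  also have "\<dots> = 1 - p * (p * x / 4)" by (simp add: field_simps)
  also have "\<dots> \<le> 1" using assms px by simp
  finally show ?thesis .
qed

text \<open>Expose a vertex \<open>v\<close> of degree \<open>d\<close>. If it is absent, at most
  \<open>2d\<close> ordered pairs are lost. If it is chosen, its \<open>d\<close> neighbours must be
  absent, which gains \<open>exp (- p * d)\<close>, while at most \<open>2d + 2rd\<close> pairs are
  lost. As \<open>p * r \<le> 1\<close>, the gain outweighs the losses on average.\<close>

lemma prob_independent_le:
  fixes p :: real and r :: nat and R :: "'a \<Rightarrow> 'a \<Rightarrow> bool"
  assumes p: "0 < p" "p \<le> 1 / 2" and r: "p * r \<le> 1"
    and sym: "\<And>v w. R v w \<Longrightarrow> R w v" and irrefl: "\<And>v. \<not> R v v"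
    and "finite V" and "\<And>v. v \<in> V \<Longrightarrow> card {w \<in> V. R v w} \<le> r"
  shows "ev p V (\<lambda>A. if \<forall>v\<in>A. \<forall>w\<in>A. \<not> R v w then 1 else 0)
    \<le> exp (- p\<^sup>2 / 16 * card {(v, w). v \<in> V \<and> w \<in> V \<and> R v w})"
  using assms(6,7)
proof (induction "card V" arbitrary: V rule: less_induct)
  case less
  note fin = less.prems(1) and deg = less.prems(2)
  let ?E = "\<lambda>V. {(v, w). v \<in> V \<and> w \<in> V \<and> R v w}"
  let ?I = "\<lambda>A. if \<forall>v\<in>A. \<forall>w\<in>A. \<not> R v w then 1 else 0 :: real"
  show ?case
  proof (cases "V = {}")
    case False
    then obtain v where v: "v \<in> V" by auto
    define N where "N = {w \<in> V. R v w}"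
    define d where "d = card N"
    have N: "N \<subseteq> V - {v}" using irrefl by (auto simp: N_def)
    have d: "d \<le> r" using deg[OF v] by (simp add: d_def N_def)
    have IH: "ev p W ?I \<le> exp (- p\<^sup>2 / 16 * card (?E W))" if "W \<subseteq> V - {v}" for W
    proof (rule less.hyps)
      show "card W < card V" using that fin v by (intro psubset_card_mono) auto
      show "finite W" using that fin finite_subset by auto
      show "card {w \<in> W. R u w} \<le> r" if "u \<in> W" for u
        using that \<open>W \<subseteq> V - {v}\<close> fin by (intro order.trans[OF card_mono deg]) auto
    qed
    have finE: "finite (?E W)" if "W \<subseteq> V" for W
      using that fin by (auto intro: finite_subset[of _ "V \<times> V"])
    have finN: "finite N" using N fin finite_subset by blast
    have e1: "card (?E V) \<le> card (?E (V - {v})) + 2 * d"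
    proof -
      have "card (?E V) \<le> card (?E (V - {v}) \<union> (Pair v ` N \<union> (\<lambda>w. (w, v)) ` N))"
        using finE[of "V - {v}"] finN sym by (intro card_mono) (auto simp: N_def image_iff)
      also have "\<dots> \<le> card (?E (V - {v})) + (card (Pair v ` N) + card ((\<lambda>w. (w, v)) ` N))"
        by (rule order.trans[OF card_Un_le add_left_mono[OF card_Un_le]])
      also have "\<dots> \<le> card (?E (V - {v})) + (d + d)"
        unfolding d_def using finN by (intro add_left_mono add_mono card_image_le)
      finally show ?thesis by simp
    qed
    have e2: "card (?E (V - {v})) \<le> card (?E (V - {v} - N)) + r * (d + d)"
      unfolding d_def
    proof (rule card_incidence_remove)
      show "card {u \<in> V - {v}. R y u} \<le> r" if "y \<in> V - {v}" for y
        using that fin by (intro order.trans[OF card_mono deg]) auto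
      show "card {y \<in> V - {v}. R y u} \<le> r" if "u \<in> V - {v}" for u
        using that fin sym by (intro order.trans[OF card_mono deg]) auto
    qed (use fin N in auto)
    define x where "x = p * d"
    have x: "0 \<le> x" "x \<le> 1"
    proof -
      have "p * d \<le> p * r" using d p by (intro mult_left_mono) auto
      then show "x \<le> 1" unfolding x_def using r by linarith
      show "0 \<le> x" using p by (simp add: x_def)
    qed
    define Y where "Y = exp (- p\<^sup>2 / 16 * card (?E V))"
    have no: "ev p (V - {v}) ?I \<le> exp (p * x / 8) * Y"
    proof -
      have "real (card (?E V)) \<le> real (card (?E (V - {v})) + 2 * d)"
        using e1 by (simp only: of_nat_le_iff)
      then have "p\<^sup>2 / 16 * card (?E V) \<le> p\<^sup>2 / 16 * (card (?E (V - {v})) + 2 * d)"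
        by (intro mult_left_mono) auto
      then have "- p\<^sup>2 / 16 * card (?E (V - {v})) \<le> p * x / 8 + - p\<^sup>2 / 16 * card (?E V)"
        by (simp add: x_def algebra_simps power2_eq_square)
      then have "exp (- p\<^sup>2 / 16 * card (?E (V - {v}))) \<le> exp (p * x / 8) * Y"
        unfolding Y_def exp_add[symmetric] by (simp only: exp_le_cancel_iff)
      then show ?thesis using IH[of "V - {v}", OF order.refl] by (rule order.trans[rotated])
    qed
    have yes: "ev p (V - {v}) (\<lambda>A. ?I (insert v A)) \<le> exp (- (13 * x / 16)) * Y"
    proof -
      have "ev p (V - {v}) (\<lambda>A. ?I (insert v A)) \<le> ev p (V - {v}) (\<lambda>A. if A \<inter> N = {} then ?I A else 0)"
        using p by (intro ev_mono) (auto simp: N_def)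
      also have "\<dots> = (1 - p) ^ d * ev p (V - {v} - N) ?I"
        unfolding d_def using fin N by (intro ev_avoid) auto
      also have "\<dots> \<le> exp (- p) ^ d * exp (- p\<^sup>2 / 16 * card (?E (V - {v} - N)))"
      proof (intro mult_mono power_mono)
        show "1 - p \<le> exp (- p)" using exp_ge_add_one_self[of "- p"] by simp
        show "ev p (V - {v} - N) ?I \<le> exp (- p\<^sup>2 / 16 * card (?E (V - {v} - N)))"
          by (rule IH) auto
        show "0 \<le> ev p (V - {v} - N) ?I" unfolding ev_def using p by (intro sum_nonneg) auto
      qed (use p in auto)
      also have "\<dots> = exp (- x - p\<^sup>2 / 16 * card (?E (V - {v} - N)))"
        unfolding exp_of_nat_mult[symmetric] exp_add[symmetric] x_def by (simp add: mult.commute)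
      also have "\<dots> \<le> exp (- (13 * x / 16) + - p\<^sup>2 / 16 * card (?E V))"
      proof -
        have "card (?E V) \<le> card (?E (V - {v} - N)) + (2 * d + 2 * (r * d))"
          using e1 e2 by (simp add: distrib_left)
        then have "real (card (?E V)) \<le> real (card (?E (V - {v} - N)) + (2 * d + 2 * (r * d)))"
          by (simp only: of_nat_le_iff)
        then have "p\<^sup>2 / 16 * card (?E V) \<le> p\<^sup>2 / 16 * (card (?E (V - {v} - N)) + (2 * d + 2 * (r * d)))"
          by (intro mult_left_mono) auto
        also have "\<dots> = p\<^sup>2 / 16 * card (?E (V - {v} - N)) + (p * x + (p * r) * x) / 8"
          by (simp add: x_def algebra_simps power2_eq_square)
        also have "\<dots> \<le> p\<^sup>2 / 16 * card (?E (V - {v} - N)) + (1 / 2 * x + 1 * x) / 8"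
          using p r x by (intro add_left_mono divide_right_mono add_mono mult_right_mono) auto
        finally show ?thesis by simp
      qed
      finally show ?thesis by (simp add: Y_def flip: exp_add)
    qed
    have "ev p V ?I \<le> (1 - p) * (exp (p * x / 8) * Y) + p * (exp (- (13 * x / 16)) * Y)"
      unfolding ev_remove[OF fin v] using p by (intro add_mono mult_left_mono no yes) auto
    also have "\<dots> = ((1 - p) * exp (p * x / 8) + p * exp (- (13 * x / 16))) * Y"
      by (simp add: algebra_simps)
    also have "\<dots> \<le> 1 * Y"
      by (intro mult_right_mono independence_step p x) (auto simp: Y_def)
    finally show ?thesis by (simp add: Y_def)
  qed simp
qed

text \<open>If \<open>X\<close> misses \<open>A + A\<close>, then \<open>A\<close> is independent in
  the graph joining distinct \<open>v\<close> and \<open>w\<close> with \<open>v + w\<close> in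
  \<open>X\<close>. Its degrees are at most \<open>|X|\<close>, and each \<open>x\<close>
  contributes at least \<open>min (x - 2) (2 * n - x)\<close> ordered pairs.\<close>

lemma prob_missing_all_le:
  fixes p :: real and n :: nat and X :: "nat set"
  assumes p: "0 < p" "p \<le> 1 / 2" and X: "X \<subseteq> {2..2 * n}" "p * card X \<le> 1"
  shows "ev p {1..n} (\<lambda>A. if X \<inter> (A + A) = {} then 1 else 0)
    \<le> (\<Prod>x\<in>X. exp (- p\<^sup>2 / 16) ^ min (x - 2) (2 * n - x))"
proof -
  have finX: "finite X" using X finite_subset by auto
  define R where "R = (\<lambda>v w. v \<noteq> w \<and> v + w \<in> X)"
  define W where "W = (\<lambda>x. {v \<in> {1..n}. v < x \<and> x - v \<in> {1..n} \<and> v + v \<noteq> x})"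
  let ?E = "{(v, w). v \<in> {1..n} \<and> w \<in> {1..n} \<and> R v w}"
  have deg: "card {w \<in> {1..n}. R v w} \<le> card X" for v
  proof -
    have "card {w \<in> {1..n}. R v w} \<le> card ((\<lambda>x. x - v) ` X)"
      using finX by (intro card_mono) (auto simp: R_def image_iff intro!: bexI[of _ "v + _"])
    then show ?thesis using card_image_le[OF finX, of "\<lambda>x. x - v"] by linarith
  qed
  have W: "min (x - 2) (2 * n - x) \<le> card (W x)" if "x \<in> X" for x
  proof -
    have x: "2 \<le> x" "x \<le> 2 * n" using that X by auto
    \<comment> \<open>All \<open>v\<close> with both \<open>v\<close> and \<open>x - v\<close> in
      \<open>[n]\<close>. Removing \<open>x div 2\<close> excludes \<open>v + v = x\<close> and
      costs at most one element whatever the parity of \<open>x\<close>.\<close>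
    let ?I = "{max 1 (x - n)..min n (x - 1)}"
    have "?I - {x div 2} \<subseteq> W x"
    proof
      fix v assume v: "v \<in> ?I - {x div 2}"
      then have "v + v \<noteq> x"
        by (metis DiffD2 insertI1 mult_2 nonzero_mult_div_cancel_left zero_neq_numeral)
      moreover have v': "1 \<le> v" "v \<le> n" "x - n \<le> v" "v \<le> x - 1" using v by simp_all
      moreover have "v < x" "x - v \<le> n" using v'(3,4) x(1) by simp_all
      ultimately show "v \<in> W x" unfolding W_def using x by simp
    qed
    moreover have "finite (W x)" by (simp add: W_def)
    ultimately have "card (?I - {x div 2}) \<le> card (W x)" by (intro card_mono)
    moreover have "card ?I - 1 \<le> card (?I - {x div 2})"
      using diff_card_le_card_Diff[of "{x div 2}" ?I] by simp
    moreover have "min (x - 2) (2 * n - x) + 1 \<le> card ?I"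
    proof (cases "x \<le> n")
      case True
      then have "max 1 (x - n) = 1" "min n (x - 1) = x - 1" by auto
      then show ?thesis using x by simp
    next
      case False
      then have "max 1 (x - n) = x - n" "min n (x - 1) = n" by auto
      then show ?thesis using x by simp
    qed
    ultimately show ?thesis by linarith
  qed
  have "(\<Sum>x\<in>X. min (x - 2) (2 * n - x)) \<le> (\<Sum>x\<in>X. card (W x))"
    using W by (rule sum_mono)
  also have "\<dots> = card (Sigma X W)"
    using finX by (subst card_SigmaI) (auto simp: W_def)
  \<comment> \<open>A pair recovers \<open>x\<close> as its sum, so different \<open>x\<close> give
    different edges.\<close>
  also have "\<dots> = card ((\<lambda>(x, v). (v, x - v)) ` Sigma X W)"
    by (intro card_image[symmetric] inj_onI) (auto simp: W_def)
  also have "\<dots> \<le> card ?E"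
    by (intro card_mono finite_subset[of ?E "{1..n} \<times> {1..n}"]) (auto simp: W_def R_def)
  finally have E: "(\<Sum>x\<in>X. min (x - 2) (2 * n - x)) \<le> card ?E" .
  have "ev p {1..n} (\<lambda>A. if X \<inter> (A + A) = {} then 1 else 0)
      \<le> ev p {1..n} (\<lambda>A. if \<forall>v\<in>A. \<forall>w\<in>A. \<not> R v w then 1 else 0)"
    using p by (intro ev_mono) (auto simp: R_def disjoint_iff set_plus_def)
  also have "\<dots> \<le> exp (- p\<^sup>2 / 16 * card ?E)"
    using deg by (intro prob_independent_le[OF p X(2)]) (auto simp: R_def add.commute)
  also have "\<dots> = exp (- p\<^sup>2 / 16) ^ card ?E"
    by (simp add: mult.commute flip: exp_of_nat_mult)
  also have "\<dots> \<le> exp (- p\<^sup>2 / 16) ^ (\<Sum>x\<in>X. min (x - 2) (2 * n - x))"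
    using E by (intro power_decreasing) auto
  also have "\<dots> = (\<Prod>x\<in>X. exp (- p\<^sup>2 / 16) ^ min (x - 2) (2 * n - x))"
    by (simp add: power_sum)
  finally show ?thesis .
qed

section \<open>Counting sets of missing sums\<close>

lemma sum_subsets_prod_le:
  fixes f :: "'a \<Rightarrow> real"
  assumes "finite M" "\<And>x. x \<in> M \<Longrightarrow> 0 \<le> f x" "sum f M \<le> s" "0 < s" "0 < r"
  shows "(\<Sum>X | X \<subseteq> M \<and> card X = r. prod f X) \<le> (exp 1 * s / r) ^ r"
proof -
  \<comment> \<open>Generating function bound: the elementary symmetric polynomial is at most
    \<open>exp (z * s) / z ^ r\<close> for every \<open>z > 0\<close>, and \<open>z = r / s\<close>
    is optimal.\<close>
  define z where "z = real r / s"
  have z: "0 < z" using assms by (simp add: z_def)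
  have "z ^ r * (\<Sum>X | X \<subseteq> M \<and> card X = r. prod f X)
      = (\<Sum>X | X \<subseteq> M \<and> card X = r. \<Prod>x\<in>X. z * f x)"
    unfolding sum_distrib_left by (intro sum.cong) (auto simp: prod.distrib)
  also have "\<dots> \<le> (\<Sum>X\<in>Pow M. \<Prod>x\<in>X. z * f x)"
    using assms z by (intro sum_mono2) (auto intro!: prod_nonneg mult_nonneg_nonneg)
  also have "\<dots> = (\<Prod>x\<in>M. z * f x + 1)"
    using assms by (simp add: prod_add)
  also have "\<dots> \<le> (\<Prod>x\<in>M. exp (z * f x))"
    using assms z by (intro prod_mono) (auto simp: add.commute intro!: exp_ge_add_one_self add_nonneg_nonneg mult_nonneg_nonneg)
  also have "\<dots> = exp (z * sum f M)"
    using assms by (simp add: exp_sum sum_distrib_left)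
  also have "\<dots> \<le> exp (z * s)" using assms z by simp
  also have "\<dots> = exp 1 ^ r" using assms by (simp add: z_def flip: exp_of_nat_mult)
  finally have "(\<Sum>X | X \<subseteq> M \<and> card X = r. prod f X) \<le> exp 1 ^ r / z ^ r"
    using z by (simp add: field_simps)
  also have "\<dots> = (exp 1 * s / r) ^ r"
    using assms by (simp add: z_def power_divide power_mult_distrib)
  finally show ?thesis .
qed

lemma sum_powers_le:
  fixes a :: real
  assumes "finite T" "\<And>k. k \<in> T \<Longrightarrow> l \<le> k" "0 \<le> a" "a < 1"
  shows "(\<Sum>k\<in>T. a ^ k) \<le> a ^ l / (1 - a)"
proof -
  have "inj_on (\<lambda>k. k - l) T"
    using assms(2) by (intro inj_onI) (metis le_add_diff_inverse2)
  then have "(\<Sum>k\<in>T. a ^ k) = (\<Sum>j\<in>(\<lambda>k. k - l) ` T. a ^ l * a ^ j)"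
    using assms(2) by (subst sum.reindex) (auto simp flip: power_add)
  also have "\<dots> = a ^ l * (\<Sum>j\<in>(\<lambda>k. k - l) ` T. a ^ j)"
    by (simp add: sum_distrib_left)
  also have "\<dots> \<le> a ^ l * (\<Sum>j. a ^ j)"
    using assms by (intro mult_left_mono sum_le_suminf) auto
  finally show ?thesis using assms by (simp add: suminf_geometric)
qed

text \<open>Any \<open>t\<close> missing sums contain at least \<open>(t / r) ^ r\<close> missing
  \<open>r\<close>-sets, whereas the expected number of those is at most
  \<open>(e * s / r) ^ r\<close>. This leaves \<open>(e * s / t) ^ r\<close>, and
  \<open>e \<le> 3\<close> with \<open>192 = 3 * 64\<close> brings the base down to
  \<open>a ^ (L - 1)\<close>.\<close>

lemma prob_middle_missing_le:
  fixes p :: real and n L t r :: nat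
  assumes p: "0 < p" "p \<le> 1 / 2" and r: "0 < r" "r \<le> t" "p * r \<le> 1"
    and L: "1 \<le> L" and t: "192 \<le> p\<^sup>2 * t"
  shows "ev p {1..n} (indicator {A. t \<le> card ({L<..2 * n - L} - (A + A))})
    \<le> exp (- p\<^sup>2 / 16 * (L - 1) * r)"
proof -
  define M where "M = {L<..2 * n - L}"
  define a where "a = exp (- p\<^sup>2 / 16)"
  define f where "f = (\<lambda>x. a ^ min (x - 2) (2 * n - x))"
  \<comment> \<open>Bounds two geometric tails from \<open>a ^ (L - 1)\<close> on, each with
    \<open>1 / (1 - a) \<le> 32 / p\<^sup>2\<close>.\<close>
  define s where "s = 64 * a ^ (L - 1) / p\<^sup>2"
  have finM: "finite M" by (simp add: M_def)
  have a: "0 < a" "a < 1" using p by (auto simp: a_def)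
  have p2: "0 < p\<^sup>2" "p\<^sup>2 \<le> 1" using p by (auto simp: power_le_one)
  have a1: "p\<^sup>2 / 32 \<le> 1 - a"
  proof -
    have "a * (1 + p\<^sup>2 / 16) \<le> a * exp (p\<^sup>2 / 16)"
      using a by (intro mult_left_mono exp_ge_add_one_self) auto
    also have "\<dots> = 1" by (simp add: a_def flip: exp_add)
    also have "1 \<le> (1 - p\<^sup>2 / 32) * (1 + p\<^sup>2 / 16)"
    proof -
      have "1 \<le> (1 - q / 32) * (1 + q / 16)" if "0 < q" "q \<le> 1" for q :: real
      proof -
        have "q * q \<le> q * 1" using that by (intro mult_left_mono) auto
        then show ?thesis using that by (simp add: algebra_simps)
      qed
      then show ?thesis using p2 by blast
    qed
    finally have "a \<le> 1 - p\<^sup>2 / 32" by (rule mult_right_le_imp_le) (use p2(1) in linarith)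
    then show ?thesis by simp
  qed
  have "sum f M \<le> (\<Sum>x\<in>M. a ^ (x - 2) + a ^ (2 * n - x))"
    using a by (intro sum_mono) (auto simp: f_def min_def)
  also have "\<dots> = (\<Sum>x\<in>M. a ^ (x - 2)) + (\<Sum>x\<in>M. a ^ (2 * n - x))"
    by (rule sum.distrib)
  also have "\<dots> = (\<Sum>k\<in>(\<lambda>x. x - 2) ` M. a ^ k) + (\<Sum>k\<in>(\<lambda>x. 2 * n - x) ` M. a ^ k)"
    using L by (intro arg_cong2[of _ _ _ _ "(+)"] sum.reindex_cong[symmetric, OF _ refl refl])
      (auto simp: inj_on_def M_def)
  also have "\<dots> \<le> a ^ (L - 1) / (1 - a) + a ^ (L - 1) / (1 - a)"
    using a finM by (intro add_mono sum_powers_le) (auto simp: M_def)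
  also have "\<dots> = 2 * a ^ (L - 1) / (1 - a)" by simp
  also have "\<dots> \<le> 2 * a ^ (L - 1) / (p\<^sup>2 / 32)"
    using a(1) a1 p2(1) by (intro divide_left_mono mult_pos_pos) (simp_all add: \<open>a < 1\<close>)
  finally have s: "sum f M \<le> s" by (simp add: s_def)
  have "0 < s" using a p2 by (simp add: s_def)
  have M2: "M \<subseteq> {2..2 * n}" using L by (auto simp: M_def)
  let ?B = "\<lambda>A. {X. X \<subseteq> M - (A + A) \<and> card X = r}"
  let ?X = "{X. X \<subseteq> M \<and> card X = r}"
  have "real (t choose r) * ev p {1..n} (indicator {A. t \<le> card (M - (A + A))})
      = ev p {1..n} (\<lambda>A. real (t choose r) * indicator {A. t \<le> card (M - (A + A))} A)"
    by (simp add: ev_cmult)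
  also have "\<dots> \<le> ev p {1..n} (\<lambda>A. \<Sum>X\<in>?X. if X \<inter> (A + A) = {} then 1 else 0)"
  proof (rule ev_mono)
    fix A :: "nat set"
    have "(\<Sum>X\<in>?X. if X \<inter> (A + A) = {} then 1 else 0 :: real) = (\<Sum>X\<in>?B A. 1)"
      using finM by (intro sum.mono_neutral_cong_right) auto
    also have "\<dots> = real (card (M - (A + A)) choose r)"
      using finM by (simp add: n_subsets)
    finally show "real (t choose r) * indicator {A. t \<le> card (M - (A + A))} A
        \<le> (\<Sum>X\<in>?X. if X \<inter> (A + A) = {} then 1 else 0)"
      by (auto simp: indicator_def intro: binomial_right_mono)
  qed (use p in auto)
  also have "\<dots> = (\<Sum>X\<in>?X. ev p {1..n} (\<lambda>A. if X \<inter> (A + A) = {} then 1 else 0))"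
    by (rule ev_sum)
  also have "\<dots> \<le> (\<Sum>X\<in>?X. prod f X)"
    unfolding f_def a_def
    using r M2 by (intro sum_mono prob_missing_all_le p) auto
  also have "\<dots> \<le> (exp 1 * s / r) ^ r"
    using a finM s \<open>0 < s\<close> r by (intro sum_subsets_prod_le) (auto simp: f_def)
  finally have "real (t choose r) * ev p {1..n} (indicator {A. t \<le> card (M - (A + A))}) \<le> (exp 1 * s / r) ^ r" .
  moreover have "(real t / real r) ^ r \<le> real (t choose r)"
    by (rule binomial_ge_n_over_k_pow_k[OF r(2)])
  moreover have "0 \<le> ev p {1..n} (indicator {A. t \<le> card (M - (A + A))})"
    unfolding ev_def using p by (intro sum_nonneg) auto
  ultimately have "(real t / real r) ^ r * ev p {1..n} (indicator {A. t \<le> card (M - (A + A))}) \<le> (exp 1 * s / r) ^ r"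
    by (meson mult_right_mono order_trans)
  then have "ev p {1..n} (indicator {A. t \<le> card (M - (A + A))}) \<le> (exp 1 * s / r) ^ r / (real t / real r) ^ r"
    using r by (simp add: field_simps)
  also have "\<dots> = (exp 1 * s / t) ^ r"
    using r by (simp add: power_divide)
  also have "\<dots> \<le> (a ^ (L - 1)) ^ r"
  proof (intro power_mono)
    have "exp 1 * s \<le> 3 * s" using exp_le \<open>0 < s\<close> by (intro mult_right_mono) auto
    also have "\<dots> = 192 * (a ^ (L - 1) / p\<^sup>2)" by (simp add: s_def)
    also have "\<dots> \<le> (p\<^sup>2 * t) * (a ^ (L - 1) / p\<^sup>2)"
      using t a p2 by (intro mult_right_mono) auto
    also have "\<dots> = a ^ (L - 1) * t" using p2 by simp
    finally show "exp 1 * s / t \<le> a ^ (L - 1)" using r by (simp add: field_simps)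
  qed (use \<open>0 < s\<close> in auto)
  also have "\<dots> = exp (- p\<^sup>2 / 16 * (L - 1) * r)"
    using L by (simp add: a_def mult_ac flip: exp_of_nat_mult)
  finally show ?thesis by (simp add: M_def)
qed

section \<open>Gluing the two ends\<close>

text \<open>\<open>h\<close> identifies \<open>[2L]\<close> with the first and last \<open>L\<close>
  elements of \<open>[n]\<close>. A sum up to \<open>L\<close> involves only the first, a sum above
  \<open>2n - L\<close> only the last, so missing end sums of \<open>A\<close> become missing sums
  of the glued set, which is again \<open>p\<close>-random.\<close>

lemma prob_missing_split:
  fixes p :: real and n L m t :: nat
  assumes p: "0 \<le> p" "p \<le> 1" and n: "2 * L \<le> n"
  shows "ev p {1..n} (indicator {A. m \<le> card ({1..2 * n} - (A + A))})
    \<le> ev p {1..n} (indicator {A. t \<le> card ({L<..2 * n - L} - (A + A))})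
      + ev p {1..2 * L} (indicator {A. m - t \<le> card ({1..2 * (2 * L)} - (A + A))})"
proof -
  define h where "h = (\<lambda>i. if i \<le> L then i else i + (n - 2 * L))"
  define V where "V = h ` {1..2 * L}"
  define P where "P = (\<lambda>A. {i \<in> {1..2 * L}. h i \<in> A})"
  define J :: "nat set \<Rightarrow> real" where
    "J = indicator {A. m - t \<le> card ({1..2 * (2 * L)} - (A + A))}"
  have inj: "inj_on h {1..2 * L}"
    by (auto simp: inj_on_def h_def split: if_splits)
  have V: "V \<subseteq> {1..n}"
    using n by (auto simp: V_def h_def)
  \<comment> \<open>\<open>P A\<close> depends only on the two ends of \<open>A\<close>; therefore
    \<open>ev_restrict\<close> reduces its expectation to \<open>V\<close>, and
    \<open>ev_image\<close> carries it to \<open>[2L]\<close>.\<close>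
  have PV: "P A = P (A \<inter> V)" for A
    by (auto simp: P_def V_def)
  have count: "card ({1..2 * n} - (A + A))
      \<le> card ({L<..2 * n - L} - (A + A)) + card ({1..2 * (2 * L)} - (P A + P A))" for A :: "nat set"
  proof -
    let ?T = "A + A"
    let ?M = "{L<..2 * n - L} - ?T"
    let ?E = "({1..L} \<union> {2 * n - L<..2 * n}) - ?T"
    \<comment> \<open>The map of sums that matches \<open>h\<close>: the top \<open>L\<close> sums
      move down by twice \<open>n - 2L\<close>.\<close>
    define g where "g = (\<lambda>x. if x \<le> L then x else x - (2 * n - 4 * L))"
    have "inj_on g ?E"
    proof (rule inj_onI)
      fix x y assume "x \<in> ?E" "y \<in> ?E" "g x = g y"
      then show "x = y" using n by (simp add: g_def split: if_splits) linarith+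
    qed
    moreover have "g ` ?E \<subseteq> {1..2 * (2 * L)} - (P A + P A)"
    proof
      fix z assume "z \<in> g ` ?E"
      then obtain x where x: "x \<in> ?E" "z = g x" by blast
      have "z \<notin> P A + P A"
      proof
        assume "z \<in> P A + P A"
        then obtain i j where ij: "i \<in> P A" "j \<in> P A" "z = i + j" by (auto simp: set_plus_def)
        then have le: "1 \<le> i" "i \<le> 2 * L" "1 \<le> j" "j \<le> 2 * L" and hA: "h i \<in> A" "h j \<in> A"
          by (auto simp: P_def)
        have "h i + h j = x"
        proof (cases "x \<le> L")
          case True
          then have "i + j = x" using x(2) ij(3) by (simp add: g_def)
          then show ?thesis using True by (simp add: h_def)
        next
          case False
          then have "2 * n - L < x" "i + j = x - (2 * n - 4 * L)" using x ij(3) by (auto simp: g_def)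
          then have ij': "i + j + 2 * n = x + 4 * L" using n by linarith
          \<comment> \<open>Since \<open>i + j > 3L\<close> and both are at most \<open>2L\<close>,
            both lie in the upper half, where \<open>h\<close> shifts by
            \<open>n - 2L\<close>.\<close>
          then have "L < i" "L < j" using le \<open>2 * n - L < x\<close> by linarith+
          then show ?thesis using ij' n by (simp add: h_def)
        qed
        then have "x \<in> ?T" using hA by (auto simp: set_plus_def)
        then show False using x(1) by simp
      qed
      moreover have "z \<in> {1..2 * (2 * L)}"
      proof (cases "x \<le> L")
        case True
        then show ?thesis using x by (auto simp: g_def)
      next
        case False
        then have "2 * n - L < x" "x \<le> 2 * n" using x(1) by auto
        then show ?thesis using False n x(2) by (simp add: g_def) linarith
      qed
      ultimately show "z \<in> {1..2 * (2 * L)} - (P A + P A)" by simp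
    qed
    ultimately have "card ?E \<le> card ({1..2 * (2 * L)} - (P A + P A))"
      by (intro card_inj_on_le) auto
    moreover have "card ({1..2 * n} - ?T) \<le> card (?M \<union> ?E)"
      by (intro card_mono) auto
    moreover have "card (?M \<union> ?E) \<le> card ?M + card ?E" by (rule card_Un_le)
    ultimately show ?thesis by linarith
  qed
  have "ev p {1..n} (indicator {A. m \<le> card ({1..2 * n} - (A + A))})
      \<le> ev p {1..n} (\<lambda>A. indicator {A. t \<le> card ({L<..2 * n - L} - (A + A))} A + J (P (A \<inter> V)))"
  proof (rule ev_mono[OF p])
    fix A :: "nat set"
    have "t \<le> card ({L<..2 * n - L} - (A + A)) \<or> m - t \<le> card ({1..2 * (2 * L)} - (P A + P A))"
      if "m \<le> card ({1..2 * n} - (A + A))"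
      using that count[of A] by linarith
    then show "indicator {A. m \<le> card ({1..2 * n} - (A + A))} A
        \<le> indicator {A. t \<le> card ({L<..2 * n - L} - (A + A))} A + J (P (A \<inter> V))"
      unfolding J_def PV[symmetric] by (auto simp: indicator_def)
  qed
  also have "\<dots> = ev p {1..n} (indicator {A. t \<le> card ({L<..2 * n - L} - (A + A))}) + ev p V (\<lambda>A. J (P A))"
    unfolding ev_add using ev_restrict[OF _ V, of p "\<lambda>A. J (P A)"] by simp
  also have "ev p V (\<lambda>A. J (P A)) = ev p {1..2 * L} (\<lambda>A. J (P (h ` A)))"
    unfolding V_def using inj by (intro ev_image) auto
  also have "\<dots> = ev p {1..2 * L} J"
  proof (rule ev_cong)
    fix A assume A: "A \<subseteq> {1..2 * L}"
    then have "P (h ` A) = A"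
      using inj_on_image_mem_iff[OF inj _ A] by (auto simp: P_def)
    then show "J (P (h ` A)) = J A" by simp
  qed
  finally show ?thesis unfolding J_def .
qed

section \<open>Choice of the parameters\<close>

lemma prob_missing_short_le:
  fixes p \<epsilon> \<kappa> :: real and N m m' :: nat
  assumes p: "0 < p" "p \<le> 1 / 2" and \<kappa>: "1 - p = exp (- 2 * \<kappa>)" "p / 2 \<le> \<kappa>"
    and \<epsilon>: "0 < \<epsilon>" "\<epsilon> \<le> 1 / 2"
    and big: "64 * 1632\<^sup>2 * (ln (3264 / \<epsilon>))\<^sup>2 \<le> p\<^sup>2 * \<epsilon> ^ 3 * m"
    and large: "64 \<le> \<epsilon> * m"
    and N: "N \<le> 68 * m" and m': "m \<le> m' + \<epsilon> * m / 16 + 1"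
  shows "ev p {1..N} (indicator {A. m' \<le> card ({1..2 * N} - (A + A))}) \<le> exp (- \<kappa> * ((1 - \<epsilon>) * m))"
proof -
  \<comment> \<open>As \<open>3264 = 2 * 1632\<close>, \<open>2 * p * exp (- l)\<close> equals
    \<theta>. Then \<open>G\<close> and \<rho> are chosen for \<open>\<theta> * G \<ge> l\<close>
    and \<open>\<rho> * (D - 1) = l\<close>, which gives both smallness conditions of the container
    bound.\<close>
  define l where "l = ln (3264 / \<epsilon>)"
  define \<theta> where "\<theta> = p * \<epsilon> / 1632"
  define G where "G = nat \<lceil>l / \<theta>\<rceil>"
  define D where "D = nat \<lfloor>\<epsilon> * m / 8\<rfloor>"
  define \<rho> where "\<rho> = l / (D - 1)"
  have \<theta>: "0 < \<theta>" "\<theta> \<le> 1"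
  proof -
    show "0 < \<theta>" using p \<epsilon> by (simp add: \<theta>_def)
    have "p * \<epsilon> \<le> 1 * 1" using p \<epsilon> by (intro mult_mono) auto
    then show "\<theta> \<le> 1" by (simp add: \<theta>_def)
  qed
  have l1: "1 \<le> l"
  proof -
    have "3 \<le> 3264 / \<epsilon>" using \<epsilon> by (simp add: field_simps)
    then have "exp 1 \<le> 3264 / \<epsilon>" using exp_le by linarith
    then show ?thesis unfolding l_def using \<epsilon> by (subst ln_ge_iff) auto
  qed
  have exp_l: "exp (- l) = \<epsilon> / 3264"
    using \<epsilon> by (simp add: l_def exp_minus)
  have G: "l / \<theta> \<le> G" "G \<le> 2 * l / \<theta>"
  proof -
    have "0 < l / \<theta>" using l1 \<theta> by simp
    then show "l / \<theta> \<le> G" by (simp add: G_def)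
    have "G \<le> l / \<theta> + 1" unfolding G_def using \<open>0 < l / \<theta>\<close> by linarith
    also have "1 \<le> l / \<theta>" using l1 \<theta> by (simp add: field_simps)
    finally show "G \<le> 2 * l / \<theta>" by simp
  qed
  have D: "D \<le> \<epsilon> * m / 8" "\<epsilon> * m / 32 \<le> real D - 1" "0 < D"
  proof -
    show "D \<le> \<epsilon> * m / 8" unfolding D_def using large by linarith
    have "\<epsilon> * m / 8 - 1 \<le> D" unfolding D_def using large by linarith
    then show "\<epsilon> * m / 32 \<le> real D - 1" using large by linarith
    then show "0 < D" using large by (cases D) auto
  qed
  have D1: "real (D - 1) = real D - 1" "0 < real D - 1" using D large by (auto simp: of_nat_diff)
  have \<rho>0: "0 < \<rho>" using l1 D1 by (simp add: \<rho>_def)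
  \<comment> \<open>The point where the lower bound on \<open>p\<close> is spent: \<rho> is at most
    \<open>32 * l / (\<epsilon> * m)\<close> and \<open>G\<close> at most
    \<open>2 * l / \<theta>\<close>, so
    \<open>64 * l\<^sup>2 \<le> \<theta>\<^sup>2 * \<epsilon> * m\<close> suffices, and this is
    \<open>big\<close>.\<close>
  have \<rho>G: "\<rho> * G \<le> \<theta>"
  proof -
    have "\<rho> * G \<le> (l / (\<epsilon> * m / 32)) * (2 * l / \<theta>)"
    proof (intro mult_mono G(2))
      show "\<rho> \<le> l / (\<epsilon> * m / 32)"
        unfolding \<rho>_def D1(1) using l1 D large by (intro divide_left_mono) auto
    qed (use l1 large in auto)
    also have "\<dots> = 64 * l\<^sup>2 / (\<epsilon> * m * \<theta>)" by (simp add: power2_eq_square)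
    also have "\<dots> \<le> \<theta>"
    proof -
      have "64 * l\<^sup>2 \<le> p\<^sup>2 * \<epsilon> ^ 3 * m / 1632\<^sup>2"
        using big by (simp add: l_def)
      also have "\<dots> = \<theta> * (\<epsilon> * m * \<theta>)"
        by (simp add: \<theta>_def power2_eq_square power3_eq_cube)
      finally show ?thesis using large \<theta> by (simp add: divide_le_eq)
    qed
    finally show ?thesis .
  qed
  have "ev p {1..N} (indicator {A. m' \<le> card ({1..2 * N} - (A + A))})
      \<le> exp (3 * N * (\<theta> + \<rho> * G) - \<kappa> * (real m' - 2 * D - 1))"
  proof (rule prob_many_missing_le[OF p \<kappa>(1) \<theta>(1) \<rho>0 D(3)])
    have "l \<le> \<theta> * G" using G(1) \<theta> by (simp add: divide_le_eq mult.commute)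
    then have "exp (- \<theta> * G) \<le> exp (- l)" by simp
    then have "2 * p * exp (- \<theta> * G) \<le> 2 * p * exp (- l)"
      using p by (intro mult_left_mono) auto
    also have "2 * p * exp (- l) = \<theta>" unfolding exp_l \<theta>_def by simp
    finally show "2 * p * exp (- \<theta> * G) \<le> \<theta>" .
    have "\<rho> * (D - 1) = l" using D1 by (simp add: \<rho>_def)
    then have eq: "exp (- \<rho> * (D - 1)) = \<epsilon> / 3264" using exp_l by simp
    show "2 * p * exp (- \<rho> * (D - 1)) \<le> \<theta>" unfolding eq \<theta>_def by simp
  qed
  also have "\<dots> \<le> exp (- \<kappa> * ((1 - \<epsilon>) * m))"
  proof -
    \<comment> \<open>\<open>1632 = 3 * 68 * 2 * 4\<close>, so the potential uses half of the
      allowance \<open>\<epsilon> * m\<close>. The other half covers \<open>2 * D + 1\<close> and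
      the gap between \<open>m\<close> and \<open>m'\<close>.\<close>
    have "3 * N * (\<theta> + \<rho> * G) \<le> 3 * (68 * m) * (2 * \<theta>)"
      using N \<rho>G \<theta> \<rho>0 by (intro mult_mono) auto
    also have "\<dots> = (p / 2) * (\<epsilon> * m / 2)" by (simp add: \<theta>_def)
    also have "\<dots> \<le> \<kappa> * (\<epsilon> * m / 2)" using \<kappa> large by (intro mult_right_mono) auto
    finally have 1: "3 * N * (\<theta> + \<rho> * G) \<le> \<kappa> * (\<epsilon> * m / 2)" .
    have "m - \<epsilon> * m / 2 \<le> real m' - 2 * D - 1" using m' D(1) large by linarith
    then have "\<kappa> * (m - \<epsilon> * m / 2) \<le> \<kappa> * (real m' - 2 * D - 1)"
      using \<kappa> p by (intro mult_left_mono) auto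
    then show ?thesis using 1 by (simp add: algebra_simps)
  qed
  finally show ?thesis .
qed

text \<open>For \<open>n > 68 * m\<close>, about \<open>\<epsilon> * m / 16\<close> missing sums are
  conceded to the middle and the others must come from the glued ends. Each of the two events obeys
  the same bound, hence the factor 2.\<close>

lemma prob_missing_le:
  fixes p \<epsilon> \<kappa> :: real and n m :: nat
  assumes p: "0 < p" "p \<le> 1 / 2" and \<kappa>: "1 - p = exp (- 2 * \<kappa>)" "p / 2 \<le> \<kappa>" "\<kappa> \<le> p"
    and \<epsilon>: "0 < \<epsilon>" "\<epsilon> \<le> 1 / 2"
    and big: "64 * 1632\<^sup>2 * (ln (3264 / \<epsilon>))\<^sup>2 \<le> p\<^sup>2 * \<epsilon> ^ 3 * m"
    and large: "10000 \<le> p\<^sup>2 * (\<epsilon> * m)"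
  shows "ev p {1..n} (indicator {A. m \<le> card ({1..2 * n} - (A + A))}) \<le> 2 * exp (- \<kappa> * ((1 - \<epsilon>) * m))"
proof -
  have \<epsilon>m0: "0 \<le> \<epsilon> * m" using \<epsilon> by simp
  have large1: "10000 \<le> p * (\<epsilon> * m)"
  proof -
    have "p * (p * (\<epsilon> * m)) \<le> 1 * (p * (\<epsilon> * m))"
      using p by (intro mult_right_mono mult_nonneg_nonneg[OF _ \<epsilon>m0]) auto
    then show ?thesis using large by (simp add: power2_eq_square)
  qed
  have large2: "10000 \<le> \<epsilon> * m"
    using large1 mult_right_mono[of p 1 "\<epsilon> * m"] p \<epsilon>m0 by simp
  have m: "1 \<le> m" using large2 by (cases m) auto
  show ?thesis
  proof (cases "n \<le> 68 * m")
    case True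
    have "ev p {1..n} (indicator {A. m \<le> card ({1..2 * n} - (A + A))}) \<le> exp (- \<kappa> * ((1 - \<epsilon>) * m))"
      using large2 \<epsilon>m0 by (intro prob_missing_short_le[OF p \<kappa>(1,2) \<epsilon> big _ True]) auto
    then show ?thesis using exp_ge_zero[of "- \<kappa> * ((1 - \<epsilon>) * m)"] by linarith
  next
    case False
    \<comment> \<open>With \<open>34\<close>, \<open>L - 1 \<ge> 33 * m\<close>; as
      \<open>p * r \<ge> 1 / 2\<close>, the exponent for the middle is at least
      \<open>33 / 32 * p * m\<close>, more than \<open>\<kappa> * m\<close>. The size
      \<open>r\<close> is the largest with \<open>p * r \<le> 1\<close>.\<close>
    define L where "L = 34 * m"
    define t where "t = nat \<lceil>\<epsilon> * m / 16\<rceil>"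
    define r where "r = nat \<lfloor>1 / p\<rfloor>"
    have t: "\<epsilon> * m / 16 \<le> t" "t \<le> \<epsilon> * m / 16 + 1"
      unfolding t_def using \<epsilon>m0 by linarith+
    have p2: "2 \<le> 1 / p" using p by (simp add: field_simps)
    then have r: "r \<le> 1 / p" "1 / p - 1 \<le> r" "1 \<le> r"
      unfolding r_def by linarith+
    have pr: "p * r \<le> 1" "1 / 2 \<le> p * r"
    proof -
      show "p * r \<le> 1" using r(1) p by (simp add: field_simps)
      have "p * (1 / p - 1) \<le> p * r" using r(2) p by (intro mult_left_mono) auto
      then show "1 / 2 \<le> p * r" using p by (simp add: algebra_simps)
    qed
    have "1 / p \<le> \<epsilon> * m / 16" using large1 p by (simp add: field_simps)
    then have rt: "r \<le> t" using r(1) t(1) by linarith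
    have t192: "192 \<le> p\<^sup>2 * t"
    proof -
      have "p\<^sup>2 * (\<epsilon> * m / 16) \<le> p\<^sup>2 * t" using t by (intro mult_left_mono) auto
      then show ?thesis using large by simp
    qed
    have "ev p {1..n} (indicator {A. t \<le> card ({L<..2 * n - L} - (A + A))})
        \<le> exp (- p\<^sup>2 / 16 * (L - 1) * r)"
      using m r by (intro prob_middle_missing_le p rt pr(1) t192) (auto simp: L_def)
    also have "\<dots> \<le> exp (- \<kappa> * ((1 - \<epsilon>) * m))"
    proof -
      have "(1 - \<epsilon>) * m \<le> 1 * real m" using \<epsilon> by (intro mult_right_mono) auto
      then have "\<kappa> * ((1 - \<epsilon>) * m) \<le> p * (1 * real m)"
        using p(1) \<epsilon>(2) by (intro mult_mono[OF \<kappa>(3)]) auto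
      also have "\<dots> \<le> p * (33 * m) * (1 / 2) / 16" using p by simp
      also have "\<dots> \<le> p * (33 * m) * (p * r) / 16"
        using pr p by (intro divide_right_mono mult_left_mono) auto
      also have "\<dots> = p\<^sup>2 / 16 * r * (33 * m)" by (simp add: power2_eq_square)
      also have "\<dots> \<le> p\<^sup>2 / 16 * r * (L - 1)"
        using m by (intro mult_left_mono) (auto simp: L_def of_nat_diff)
      finally show ?thesis by (simp add: mult_ac)
    qed
    finally have mid: "ev p {1..n} (indicator {A. t \<le> card ({L<..2 * n - L} - (A + A))})
        \<le> exp (- \<kappa> * ((1 - \<epsilon>) * m))" .
    have ends: "ev p {1..2 * L} (indicator {A. m - t \<le> card ({1..2 * (2 * L)} - (A + A))})
        \<le> exp (- \<kappa> * ((1 - \<epsilon>) * m))"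
    proof (rule prob_missing_short_le[OF p \<kappa>(1,2) \<epsilon> big])
      have "real m - real t \<le> real (m - t)" by linarith
      then show "m \<le> (m - t) + \<epsilon> * m / 16 + 1" using t(2) by linarith
    qed (use large2 in \<open>auto simp: L_def\<close>)
    show ?thesis
      using prob_missing_split[of p L n m t] p False mid ends by (simp add: L_def)
  qed
qed

section \<open>Conclusion and the value of the constant\<close>

theorem theorem5p1:
  shows "\<exists>C::real. C > 1 \<and>
    (\<forall>(m::nat) (n::nat) (\<epsilon>::real) (p::real).
       m \<ge> 1 \<longrightarrow> n \<ge> 1 \<longrightarrow> real m \<le> 2 * real n / 3 \<longrightarrow> \<epsilon> > 0 \<longrightarrow>
       0 < p \<longrightarrow> C * log 2 (1 / \<epsilon>) / sqrt (\<epsilon> ^ 3 * real m) \<le> p \<longrightarrow> p \<le> 1 / 2 \<longrightarrow>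
       measure_pmf.prob (random_subset_pmf {1..n} p)
           {A. card ({1..2 * n} - (A + A)) \<ge> m}
         < (1 - p) powr (real m / 2 - \<epsilon> * real m))"
proof (intro exI[of _ "200000"] conjI allI impI)
  fix m n :: nat and \<epsilon> p :: real
  assume m: "m \<ge> 1" and \<epsilon>: "\<epsilon> > 0" and p: "0 < p" "p \<le> 1 / 2"
    and C: "200000 * log 2 (1 / \<epsilon>) / sqrt (\<epsilon> ^ 3 * real m) \<le> p"
  let ?Pr = "measure_pmf.prob (random_subset_pmf {1..n} p) {A. card ({1..2 * n} - (A + A)) \<ge> m}"
  define \<kappa> where "\<kappa> = - ln (1 - p) / 2"
  have \<kappa>: "1 - p = exp (- 2 * \<kappa>)" "p / 2 \<le> \<kappa>" "\<kappa> \<le> p"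
  proof -
    show "1 - p = exp (- 2 * \<kappa>)" using p by (simp add: \<kappa>_def)
    have "ln (1 + - p) \<le> - p" using p by (intro ln_add_one_self_le_self2) auto
    then show "p / 2 \<le> \<kappa>" by (simp add: \<kappa>_def)
    have "p * p \<le> p * (1 / 2)" using p by (intro mult_left_mono) auto
    moreover have "- p - 2 * p\<^sup>2 \<le> ln (1 - p)" using p by (intro ln_one_minus_pos_lower_bound) auto
    ultimately show "\<kappa> \<le> p" by (simp add: \<kappa>_def power2_eq_square)
  qed
  \<comment> \<open>In units of \<kappa> the target is \<open>(1 - 2 * \<epsilon>) * m\<close>,
    against \<open>(1 - \<epsilon>) * m\<close> in \<open>prob_missing_le\<close>. The spare
    \<open>\<epsilon> * m\<close> absorbs the factor 2 and makes the inequality strict.\<close>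
  have powr: "(1 - p) powr (real m / 2 - \<epsilon> * real m) = exp (- \<kappa> * ((1 - 2 * \<epsilon>) * m))"
    using p by (simp add: powr_def \<kappa>_def field_simps)
  show "?Pr < (1 - p) powr (real m / 2 - \<epsilon> * real m)"
  proof (cases "\<epsilon> \<le> 1 / 2")
    \<comment> \<open>For \<open>\<epsilon> > 1 / 2\<close> the exponent of \<open>1 - p\<close> is
      negative and the bound exceeds 1.\<close>
    case False
    have "?Pr \<le> 1" by (rule measure_pmf.prob_le_1)
    also have "1 < exp (- \<kappa> * ((1 - 2 * \<epsilon>) * m))"
    proof -
      have "0 < \<kappa> * ((2 * \<epsilon> - 1) * m)" using False m p \<kappa> by (intro mult_pos_pos) auto
      then show ?thesis by (simp add: algebra_simps)
    qed
    finally show ?thesis unfolding powr .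
  next
    case True
    define l where "l = log 2 (1 / \<epsilon>)"
    have l: "1 \<le> l" unfolding l_def using True \<epsilon> by (subst le_log_iff) (auto simp: field_simps)
    have ln2: "0 < ln (2::real)" "ln (2::real) \<le> 1"
      using ln_le_minus_one[of "2::real"] by auto
    have ln_eps: "ln (1 / \<epsilon>) = l * ln 2" by (simp add: l_def log_def)
    \<comment> \<open>\<open>3264 \<le> 2 ^ 12\<close> gives \<open>12 + l\<close>, which is at most
      \<open>13 * l\<close> because \<open>l \<ge> 1\<close>.\<close>
    have ln_l: "ln (3264 / \<epsilon>) \<le> 13 * l"
    proof -
      have "ln (3264 / \<epsilon>) = ln 3264 + ln (1 / \<epsilon>)"
        using \<epsilon> ln_mult[of 3264 "1 / \<epsilon>"] by simp
      also have "ln (3264::real) \<le> ln (2 ^ 12)" by (intro ln_mono) auto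
      also have "ln (2 ^ 12 :: real) = 12 * ln 2" by (subst ln_realpow) auto
      also have "12 * ln 2 + ln (1 / \<epsilon>) = (12 + l) * ln 2" by (simp add: ln_eps algebra_simps)
      also have "\<dots> \<le> (13 * l) * 1" using l ln2 by (intro mult_mono) auto
      finally show ?thesis by simp
    qed
    have ln_pos: "1 \<le> ln (3264 / \<epsilon>)"
    proof -
      have "3 \<le> 3264 / \<epsilon>" using \<epsilon> True by (simp add: field_simps)
      then have "exp 1 \<le> 3264 / \<epsilon>" using exp_le by linarith
      then show ?thesis using \<epsilon> by (subst ln_ge_iff) auto
    qed
    have pos: "0 < \<epsilon> ^ 3 * m" using \<epsilon> m by simp
    have "200000 * l \<le> p * sqrt (\<epsilon> ^ 3 * m)"
      using C pos by (simp add: l_def divide_le_eq)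
    then have "(200000 * l)\<^sup>2 \<le> (p * sqrt (\<epsilon> ^ 3 * m))\<^sup>2"
      using l by (intro power_mono) auto
    then have C2: "200000\<^sup>2 * l\<^sup>2 \<le> p\<^sup>2 * \<epsilon> ^ 3 * m"
      using pos by (simp add: power_mult_distrib)
    \<comment> \<open>The constant comes from
      \<open>64 * 1632\<^sup>2 * 13\<^sup>2 \<le> 200000\<^sup>2\<close>.\<close>
    have big: "64 * 1632\<^sup>2 * (ln (3264 / \<epsilon>))\<^sup>2 \<le> p\<^sup>2 * \<epsilon> ^ 3 * m"
    proof -
      have "(ln (3264 / \<epsilon>))\<^sup>2 \<le> (13 * l)\<^sup>2" using ln_l ln_pos by (intro power_mono) auto
      then have "64 * 1632\<^sup>2 * (ln (3264 / \<epsilon>))\<^sup>2 \<le> 64 * 1632\<^sup>2 * (13 * l)\<^sup>2"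
        by (intro mult_left_mono) auto
      also have "\<dots> \<le> 200000\<^sup>2 * l\<^sup>2" by (simp add: power_mult_distrib)
      finally show ?thesis using C2 by linarith
    qed
    have large: "10000 \<le> p\<^sup>2 * (\<epsilon> * m)"
    proof -
      have "1 * 1 \<le> l * l" using l by (intro mult_mono) auto
      then have "10000 \<le> p\<^sup>2 * \<epsilon> ^ 3 * m" using C2 by (simp add: power2_eq_square)
      also have "\<dots> = (p\<^sup>2 * (\<epsilon> * m)) * \<epsilon>\<^sup>2" by (simp add: power2_eq_square power3_eq_cube)
      also have "\<dots> \<le> (p\<^sup>2 * (\<epsilon> * m)) * 1"
        using \<epsilon> True by (intro mult_left_mono power_le_one) auto
      finally show ?thesis by simp
    qed
    have gap: "2 < exp (\<kappa> * (\<epsilon> * m))"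
    proof -
      have "p\<^sup>2 * (\<epsilon> * m) \<le> (p * 1) * (\<epsilon> * m)"
        unfolding power2_eq_square using p \<epsilon> by (intro mult_right_mono mult_left_mono) auto
      moreover have "p / 2 * (\<epsilon> * m) \<le> \<kappa> * (\<epsilon> * m)"
        using \<kappa> \<epsilon> by (intro mult_right_mono) auto
      ultimately have "1 < \<kappa> * (\<epsilon> * m)" using large by simp
      then show ?thesis using exp_ge_add_one_self[of "\<kappa> * (\<epsilon> * m)"] by linarith
    qed
    have "?Pr = ev p {1..n} (indicator {A. m \<le> card ({1..2 * n} - (A + A))})"
      using p by (intro prob_random_subset) auto
    also have "\<dots> \<le> 2 * exp (- \<kappa> * ((1 - \<epsilon>) * m))"
      by (rule prob_missing_le[OF p \<kappa> \<epsilon> True big large])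
    also have "\<dots> < exp (\<kappa> * (\<epsilon> * m)) * exp (- \<kappa> * ((1 - \<epsilon>) * m))"
      using gap by (intro mult_strict_right_mono) auto
    also have "\<dots> = exp (- \<kappa> * ((1 - 2 * \<epsilon>) * m))"
      by (simp add: algebra_simps flip: exp_add)
    finally show ?thesis unfolding powr .
  qed
qed auto

end
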